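(* Let $\varphi:=\log\circ\lambda:\Omega^*([0,1])\to C^*_\infty([0,1])$. The higher Taylor coefficients $\varphi_n$, $n\ge2$, of $\varphi$ vanish unless all of the inputs are one-forms, in which case one has $$\varphi_n(\mathbf{s}a_1(t)dt\otimes\cdots\otimes\mathbf{s}a_n(t)dt)=\left(\int_{0\le t_1\le\cdots\le t_n\le1}\frac1n\sum_{\sigma\in S_n}\frac{(-1)^{d_\sigma}}{\binom{n-1}{d_\sigma}}\,a_1(t_{\sigma(1)})\cdots a_n(t_{\sigma(n)})\,dt_1\cdots dt_n\right)\mathbf{s}dt,$$ where $d_\sigma:=|\{i\in\{1,\dots,n-1\}:\sigma(i)>\sigma(i+1)\}|$ is the descent number of $\sigma\in S_n$.
   Context: **$A_\infty$ conventions.** $\Bbbk$ is a field of characteristic zero. For a graded vector space $V$, $\mathbf{s}V$ is the suspension, $(\mathbf{s}V)^i=V^{i+1}$. $\overline{T}(V)=\bigoplus_{n\ge1}V^{\otimes n}$ carries the deconcatenation coproduct. An $A_\infty$ algebra structure on $V$ is a degree $1$ coderivation $Q$ of $\overline{T}(\mathbf{s}V)$ with $Q^2=0$; it is determined by its Taylor coefficients $Q_n:(\mathbf{s}V)^{\otimes n}\to\mathbf{s}V$. An $A_\infty$ morphism $F:V\to W$ is a morphism of dg coalgebras $\overline{T}(\mathbf{s}V)\to\overline{T}(\mathbf{s}W)$, determined by its Taylor coefficients $F_n:(\mathbf{s}V)^{\otimes n}\to\mathbf{s}W$; the composition has coefficients $(G\circ F)_n=\sum_{k}\sum_{i_1+\cdots+i_k=n}G_k(F_{i_1}\otimes\cdots\otimes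 F_{i_k})$. A dg algebra is an $A_\infty$ algebra via $Q_1(\mathbf{s}a)=-\mathbf{s}(da)$, $Q_2(\mathbf{s}a\otimes\mathbf{s}b)=(-1)^{|a|}\mathbf{s}(ab)$, $Q_n=0$ for $n\ge3$. **Forms and cochains.** $\Omega^*([0,1])$ is either the commutative dg algebra of smooth real forms on $[0,1]$ ($\Bbbk=\mathbb{R}$) or that of polynomial forms $\Bbbk[t]\oplus\Bbbk[t]dt$; in the latter case iterated integrals are evaluated formally by linear extension of $\int_{0\le t_1\le\cdots\le t_n\le s}t_1^{l_1-1}\cdots t_n^{l_n-1}dt_1\cdots dt_n=\frac{s^{l_1+\cdots+l_n}}{l_1(l_1+l_2)\cdots(l_1+\cdots+l_n)}$. $C^*([0,1])\subset\Omega^*([0,1])$ is the subcomplex of Whitney forms $\{at+b(1-t)\}\oplus\{c\,dt\}$, $a,b,c\in\Bbbk$. $C^*_\cup([0,1])$ is the dg algebra $(C^*([0,1]),d,\cup)$ with unit the constant function $1$ and $t\cup t=t$, $t\cup dt=0$, $dt\cup t=dt$. $C^*_\infty([0,1])$ is $C^*([0,1])$ with the $C_\infty$ (in particular $A_\infty$) structure, unital with respect to $1$, with Taylor coefficients: $m_1(\mathbf{s}t)=-\mathbf{s}dt$, $m_2(\mathbf{s}t\otimes\mathbf{s}t)=\mathbf{s}t$, $m_2(\mathbf{s}t\otimes\mathbf{s}dt)=\frac12\mathbf{s}dt=-m_2(\mathbf{s}dt\otimes\mathbf{s}t)$, and for $n>1$, $m_{n+1}$ vanishes unless precisely one argument is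 a function, with $m_{n+1}((\mathbf{s}dt)^{\otimes i}\otimes\mathbf{s}t\otimes(\mathbf{s}dt)^{\otimes n-i})=(-1)^{i+1}\binom{n}{i}\frac{B_n}{n!}\mathbf{s}dt$, where $\frac{z}{e^z-1}=\sum_{n\ge0}\frac{B_n}{n!}z^n$. **The morphism $\lambda$** is the $A_\infty$ morphism $\Omega^*([0,1])\to C^*_\cup([0,1])$ with $\lambda_1=\pi$, where $\pi(f)=f(1)t+f(0)(1-t)$ on functions and $\pi(a(t)dt)=\left(\int_0^1a(\tau)d\tau\right)dt$; for $n>1$, $\lambda_n$ vanishes if some factor is a zero-form; and $\lambda_n(\mathbf{s}a_1(t)dt\otimes\cdots\otimes\mathbf{s}a_n(t)dt)=\left(\int_{0\le t_1\le\cdots\le t_n\le1}a_1(t_1)\cdots a_n(t_n)dt_1\cdots dt_n\right)\mathbf{s}dt$ for $n\ge1$. **The morphism $\log$** is the $A_\infty$ isomorphism $C^*_\cup([0,1])\to C^*_\infty([0,1])$ with $\log_1=\mathrm{id}$, $\log_n$ ($n>1$) vanishing if some factor is a zero-form, and $\log_n((\mathbf{s}dt)^{\otimes n})=\frac{(-1)^{n+1}}{n}\mathbf{s}dt$ for $n\ge1$. *)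

theory Defs
  imports
    "HOL-Analysis.Analysis"
    "HOL-Library.Function_Algebras"
    "HOL-Library.Poly_Mapping"
    "HOL-Computational_Algebra.Computational_Algebra"
begin

section \<open>A-infinity algebras and morphisms in terms of Taylor coefficients\<close>

text \<open>
  A record of type \<open>('k, 'v) ainf\<close> describes a graded vector space \<open>V\<close> inside the ambient
  \<open>'k\<close>-vector space \<open>'v\<close> together with a family of maps on lists of elements of \<open>V\<close>.
  The suspension \<open>sV\<close> is not given a type of its own: \<open>s x\<close> is represented by \<open>x\<close>, so an element
  of \<open>V\<close> of degree \<open>d\<close> has degree \<open>d - 1\<close> in \<open>sV\<close>. The value of the \<open>n\<close>-th Taylor coefficient at
  \<open>s x\<^sub>1 \<otimes> \<dots> \<otimes> s x\<^sub>n\<close> is the value of the family at the list \<open>[x\<^sub>1, \<dots>, x\<^sub>n]\<close>; the value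
  at the empty list carries no meaning.
\<close>

record ('k, 'v) ainf =
  ainf_scale :: "'k \<Rightarrow> 'v \<Rightarrow> 'v"
  ainf_hom :: "int \<Rightarrow> 'v set"
  ainf_coeff :: "'v list \<Rightarrow> 'v"

definition ainf_carrier :: "('k, 'v::ab_group_add) ainf \<Rightarrow> 'v set" where
  "ainf_carrier A = {\<Sum>d\<in>D. x d | D x. finite D \<and> (\<forall>d\<in>D. x d \<in> ainf_hom A d)}"

definition graded_vector_space :: "('k::field, 'v::ab_group_add) ainf \<Rightarrow> bool" where
  "graded_vector_space A \<longleftrightarrow>
     vector_space (ainf_scale A) \<and>
     (\<forall>d. module.subspace (ainf_scale A) (ainf_hom A d)) \<and>
     (\<forall>D x. finite D \<longrightarrow> (\<forall>d\<in>D. x d \<in> ainf_hom A d) \<longrightarrow> (\<Sum>d\<in>D. x d) = 0 \<longrightarrow> (\<forall>d\<in>D. x d = 0))"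

definition multilinear_coeffs ::
    "('k::field, 'v::ab_group_add) ainf \<Rightarrow> ('k, 'w::ab_group_add) ainf \<Rightarrow> ('v list \<Rightarrow> 'w) \<Rightarrow> bool" where
  "multilinear_coeffs A B F \<longleftrightarrow>
     (\<forall>us ws x y c. set us \<subseteq> ainf_carrier A \<longrightarrow> set ws \<subseteq> ainf_carrier A \<longrightarrow>
        x \<in> ainf_carrier A \<longrightarrow> y \<in> ainf_carrier A \<longrightarrow>
        F (us @ [x + y] @ ws) = F (us @ [x] @ ws) + F (us @ [y] @ ws) \<and>
        F (us @ [ainf_scale A c x] @ ws) = ainf_scale B c (F (us @ [x] @ ws)))"

text \<open>\<open>xs\<close> is a list of homogeneous elements of \<open>V\<close> of degrees \<open>ds\<close>.\<close>

definition homogeneous_list :: "('k, 'v) ainf \<Rightarrow> 'v list \<Rightarrow> int list \<Rightarrow> bool" where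
  "homogeneous_list A xs ds \<longleftrightarrow> list_all2 (\<lambda>x d. x \<in> ainf_hom A d) xs ds"

definition susp_degree :: "int list \<Rightarrow> int" where
  "susp_degree ds = (\<Sum>d\<leftarrow>ds. d - 1)"

text \<open>The family \<open>F\<close> has degree \<open>e\<close> as a family of maps from tensor powers of \<open>sV\<close> to \<open>sW\<close>.\<close>

definition coeffs_of_degree ::
    "('k, 'v) ainf \<Rightarrow> ('k, 'w) ainf \<Rightarrow> int \<Rightarrow> ('v list \<Rightarrow> 'w) \<Rightarrow> bool" where
  "coeffs_of_degree A B e F \<longleftrightarrow>
     (\<forall>xs ds. xs \<noteq> [] \<longrightarrow> homogeneous_list A xs ds \<longrightarrow> F xs \<in> ainf_hom B (susp_degree ds + e + 1))"

text \<open>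
  The corestriction to \<open>sW\<close> of \<open>F \<circ> Q\<close>, where \<open>Q\<close> is the coderivation with Taylor coefficients
  \<open>ainf_coeff A\<close>: the sum of all
  \<open>\<plusminus> F\<^bsub>i+1+l\<^esub> (x\<^sub>1, \<dots>, x\<^sub>i, Q\<^sub>j (x\<^bsub>i+1\<^esub>, \<dots>, x\<^bsub>i+j\<^esub>), x\<^bsub>i+j+1\<^esub>, \<dots>, x\<^sub>n)\<close>
  with \<open>i + j + l = n\<close> and \<open>j \<ge> 1\<close>. The sign is the Koszul sign of moving \<open>Q\<close>, of degree 1,
  past \<open>s x\<^sub>1, \<dots>, s x\<^sub>i\<close>.
\<close>

definition after_coderivation ::
    "('k::field, 'v) ainf \<Rightarrow> ('k, 'w::ab_group_add) ainf \<Rightarrow> ('v list \<Rightarrow> 'w) \<Rightarrow> 'v list \<Rightarrow> int list \<Rightarrow> 'w" where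
  "after_coderivation A B F xs ds =
     (\<Sum>i<length xs. \<Sum>j = 1..length xs - i.
        ainf_scale B (if even (susp_degree (take i ds)) then 1 else - 1)
          (F (take i xs @ [ainf_coeff A (take j (drop i xs))] @ drop (i + j) xs)))"

text \<open>
  Since \<open>Q\<close> is odd, \<open>Q\<^sup>2\<close> is again a coderivation, so \<open>Q\<^sup>2 = 0\<close> is equivalent to the vanishing
  of the corestriction of \<open>Q\<^sup>2\<close>.
\<close>

definition ainf_algebra :: "('k::field, 'v::ab_group_add) ainf \<Rightarrow> bool" where
  "ainf_algebra A \<longleftrightarrow>
     graded_vector_space A \<and>
     multilinear_coeffs A A (ainf_coeff A) \<and>
     coeffs_of_degree A A 1 (ainf_coeff A) \<and>
     (\<forall>xs ds. xs \<noteq> [] \<longrightarrow> homogeneous_list A xs ds \<longrightarrow>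
        after_coderivation A A (ainf_coeff A) xs ds = 0)"

text \<open>
  Composition of Taylor coefficients: the sum of \<open>G\<^sub>k (F\<^bsub>i\<^sub>1\<^esub> \<otimes> \<dots> \<otimes> F\<^bsub>i\<^sub>k\<^esub>)\<close> over all
  \<open>i\<^sub>1 + \<dots> + i\<^sub>k = n\<close> with \<open>i\<^sub>j \<ge> 1\<close>, a composition of \<open>n\<close> being encoded as the division of
  the input list into consecutive nonempty blocks. There are no signs because \<open>F\<close> has degree 0.
\<close>

definition blocks :: "'a list \<Rightarrow> 'a list list set" where
  "blocks xs = {bs. concat bs = xs \<and> [] \<notin> set bs}"

definition ainf_comp :: "('w list \<Rightarrow> 'u::ab_group_add) \<Rightarrow> ('v list \<Rightarrow> 'w) \<Rightarrow> 'v list \<Rightarrow> 'u" where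
  "ainf_comp G F xs = (\<Sum>bs\<in>blocks xs. G (map F bs))"

text \<open>
  The last condition is compatibility with the codifferentials, corestricted to \<open>sW\<close>
  (both sides are coderivations along the coalgebra morphism given by \<open>F\<close>).
\<close>

definition ainf_morphism ::
    "('k::field, 'v::ab_group_add) ainf \<Rightarrow> ('k, 'w::ab_group_add) ainf \<Rightarrow> ('v list \<Rightarrow> 'w) \<Rightarrow> bool" where
  "ainf_morphism A B F \<longleftrightarrow>
     ainf_algebra A \<and> ainf_algebra B \<and>
     multilinear_coeffs A B F \<and>
     coeffs_of_degree A B 0 F \<and>
     (\<forall>xs ds. xs \<noteq> [] \<longrightarrow> homogeneous_list A xs ds \<longrightarrow>
        ainf_comp (ainf_coeff B) F xs = after_coderivation A B F xs ds)"

text \<open>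
  The Taylor coefficients of a dg algebra: \<open>Q\<^sub>1 (s a) = - s (d a)\<close> and
  \<open>Q\<^sub>2 (s a \<otimes> s b) = (-1)\<^bsup>|a|\<^esup> s (a b)\<close>. The argument \<open>\<epsilon>\<close> is the linear map
  multiplying an element of degree \<open>i\<close> by \<open>(-1)\<^sup>i\<close>.
\<close>

definition dga_coeff ::
    "('v \<Rightarrow> 'v) \<Rightarrow> ('v \<Rightarrow> 'v \<Rightarrow> 'v) \<Rightarrow> ('v \<Rightarrow> 'v) \<Rightarrow> 'v list \<Rightarrow> 'v::ab_group_add" where
  "dga_coeff d mul \<epsilon> xs =
     (case xs of [x] \<Rightarrow> - d x | [x, y] \<Rightarrow> mul (\<epsilon> x) y | _ \<Rightarrow> 0)"


section \<open>Differential forms on the unit interval\<close>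

text \<open>
  The pair \<open>(f, a)\<close> stands for the form \<open>f(t) + a(t) dt\<close>. The parameters are the scalar
  multiplication of functions, the set of admissible functions and the derivative.
\<close>

definition form_mult :: "'f \<times> 'f \<Rightarrow> 'f \<times> 'f \<Rightarrow> 'f \<times> 'f::comm_ring" where
  "form_mult = (\<lambda>(f, a) (g, b). (f * g, f * b + a * g))"

definition forms ::
    "('k \<Rightarrow> 'f \<Rightarrow> 'f) \<Rightarrow> 'f set \<Rightarrow> ('f \<Rightarrow> 'f) \<Rightarrow> ('k, 'f \<times> 'f::comm_ring) ainf" where
  "forms smul S D =
     \<lparr> ainf_scale = (\<lambda>c (f, a). (smul c f, smul c a)),
       ainf_hom = (\<lambda>i. if i = 0 then {(f, 0) | f. f \<in> S}
                       else if i = 1 then {(0, a) | a. a \<in> S} else {0}),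
       ainf_coeff = dga_coeff (\<lambda>(f, a). (0, D f)) form_mult (\<lambda>(f, a). (f, - a)) \<rparr>"

definition one_form :: "'f::zero \<Rightarrow> 'f \<times> 'f" where
  "one_form a = (0, a)"

text \<open>
  Smooth functions on \<open>[0,1]\<close> (one-sided derivatives at the end points) are represented by
  their extension by zero to the real line, so that equality of representatives is equality on
  \<open>[0,1]\<close>. Addition and multiplication are pointwise.
\<close>

definition smooth_funs :: "(real \<Rightarrow> real) set" where
  "smooth_funs = {f. (\<exists>g :: nat \<Rightarrow> real \<Rightarrow> real. g 0 = f \<and>
       (\<forall>n. \<forall>x\<in>{0..1}. (g n has_real_derivative g (Suc n) x) (at x within {0..1}))) \<and>
     (\<forall>x. x \<notin> {0..1} \<longrightarrow> f x = 0)}"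

definition Omega_smooth :: "(real, (real \<Rightarrow> real) \<times> (real \<Rightarrow> real)) ainf" where
  "Omega_smooth = forms (\<lambda>c f x. c * f x) smooth_funs
     (\<lambda>f x. if x \<in> {0..1} then vector_derivative f (at x within {0..1}) else 0)"

definition Omega_poly :: "('k, 'k::field_char_0 poly \<times> 'k poly) ainf" where
  "Omega_poly = forms smult UNIV pderiv"


section \<open>Iterated integrals\<close>

definition std_simplex :: "nat \<Rightarrow> (nat \<Rightarrow> real) set" where
  "std_simplex n = {t. (\<forall>i\<in>{1..n}. 0 \<le> t i \<and> t i \<le> 1) \<and> (\<forall>i\<in>{1..<n}. t i \<le> t (i + 1))}"

definition simplex_integral :: "nat \<Rightarrow> ((nat \<Rightarrow> real) \<Rightarrow> real) \<Rightarrow> real" where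
  "simplex_integral n f = set_lebesgue_integral (PiM {1..n} (\<lambda>_. lborel)) (std_simplex n) f"

text \<open>
  Polynomials in the variables \<open>t\<^sub>1, t\<^sub>2, \<dots>\<close> are finitely supported functions from exponent
  vectors to coefficients; \<open>poly_in_var j p\<close> is \<open>p(t\<^sub>j)\<close>.
\<close>

type_synonym 'k multipoly = "(nat \<Rightarrow>\<^sub>0 nat) \<Rightarrow>\<^sub>0 'k"

definition multipoly_const :: "'k::comm_ring_1 \<Rightarrow> 'k multipoly" where
  "multipoly_const c = Poly_Mapping.single 0 c"

definition poly_in_var :: "nat \<Rightarrow> 'k::comm_ring_1 poly \<Rightarrow> 'k multipoly" where
  "poly_in_var j p = (\<Sum>i\<le>degree p. Poly_Mapping.single (Poly_Mapping.single j i) (coeff p i))"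

text \<open>
  The monomial with exponents \<open>l\<^sub>1 - 1, \<dots>, l\<^sub>n - 1\<close> has the integral
  \<open>1 / (l\<^sub>1 (l\<^sub>1 + l\<^sub>2) \<dots> (l\<^sub>1 + \<dots> + l\<^sub>n))\<close> over the simplex \<open>0 \<le> t\<^sub>1 \<le> \<dots> \<le> t\<^sub>n \<le> 1\<close>.
\<close>

definition formal_simplex_integral :: "nat \<Rightarrow> 'k::field_char_0 multipoly \<Rightarrow> 'k" where
  "formal_simplex_integral n P =
     (\<Sum>m\<in>Poly_Mapping.keys P. Poly_Mapping.lookup P m /
        (\<Prod>j = 1..n. \<Sum>i = 1..j. of_nat (Poly_Mapping.lookup m i + 1)))"


section \<open>Whitney cochains\<close>

text \<open>The triple \<open>(a, b, c)\<close> stands for the Whitney form \<open>a t + b (1 - t) + c dt\<close>.\<close>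

type_synonym 'k cochain = "'k \<times> 'k \<times> 'k"

definition cochain_scale :: "'k \<Rightarrow> 'k cochain \<Rightarrow> 'k::field cochain" where
  "cochain_scale r = (\<lambda>(a, b, c). (r * a, r * b, r * c))"

definition cochain_hom :: "int \<Rightarrow> 'k::field cochain set" where
  "cochain_hom i = (if i = 0 then {(a, b, 0) | a b. True}
                    else if i = 1 then {(0, 0, c) | c. True} else {0})"

abbreviation cochain_one :: "'k::field cochain" where "cochain_one \<equiv> (1, 1, 0)"
abbreviation cochain_t :: "'k::field cochain" where "cochain_t \<equiv> (1, 0, 0)"
abbreviation cochain_dt :: "'k::field cochain" where "cochain_dt \<equiv> (0, 0, 1)"

text \<open>
  The bilinear product with unit \<open>1\<close> and \<open>t \<union> t = t\<close>, \<open>t \<union> dt = 0\<close>, \<open>dt \<union> t = dt\<close>; in terms of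
  the basis \<open>t, 1 - t, dt\<close> this is the simplicial cup product.
\<close>

definition cup :: "'k cochain \<Rightarrow> 'k cochain \<Rightarrow> 'k::field cochain" where
  "cup = (\<lambda>(a, b, c) (a', b', c'). (a * a', b * b', b * c' + c * a'))"

lemma cup_table:
  "cup cochain_one x = x" "cup x cochain_one = x"
  "cup cochain_t cochain_t = cochain_t"
  "cup cochain_t cochain_dt = 0"
  "cup cochain_dt cochain_t = cochain_dt"
  "cup cochain_dt cochain_dt = 0"
  by (auto simp: cup_def zero_prod_def split: prod.splits)

definition C_cup :: "('k, 'k::field_char_0 cochain) ainf" where
  "C_cup =
     \<lparr> ainf_scale = cochain_scale, ainf_hom = cochain_hom,
       ainf_coeff = dga_coeff (\<lambda>(a, b, c). (0, 0, a - b)) cup (\<lambda>(a, b, c). (a, b, - c)) \<rparr>"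

text \<open>\<open>bernoulli_coeff n\<close> is \<open>B\<^sub>n / n!\<close>, the coefficient of \<open>z\<^sup>n\<close> in \<open>z / (e\<^sup>z - 1)\<close>.\<close>

definition bernoulli_coeff :: "nat \<Rightarrow> 'k::field_char_0" where
  "bernoulli_coeff n = fps_nth (fps_X / (fps_exp 1 - 1)) n"

text \<open>
  The part of \<open>m\<^bsub>n+1\<^esub>\<close> with exactly one function among its inputs, as an element of \<open>'k\<close>
  multiplying \<open>dt\<close>. A function \<open>a t + b (1 - t)\<close> equals \<open>(a - b) t + b 1\<close>, and for
  \<open>n \<noteq> 1\<close> inputs equal to \<open>1\<close> contribute zero by unitality.
\<close>

definition C_inf_dt_part :: "'k::field_char_0 cochain list \<Rightarrow> 'k" where
  "C_inf_dt_part xs =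
     (let n = length xs - 1 in
      \<Sum>i\<le>n. (- 1) ^ (i + 1) * of_nat (n choose i) * bernoulli_coeff n *
        ((case xs ! i of (a, b, c) \<Rightarrow> a - b) * (\<Prod>j\<in>{..n} - {i}. snd (snd (xs ! j)))))"

text \<open>
  For two inputs, \<open>m\<^sub>2 (t, t) = t\<close>, \<open>m\<^sub>2 (t, dt) = dt / 2 = - m\<^sub>2 (dt, t)\<close>, and unitality means
  \<open>m\<^sub>2 (1, x) = x\<close> and \<open>m\<^sub>2 (x, 1) = (-1)\<^bsup>|x|\<^esup> x\<close> (suspensions omitted).
\<close>

definition C_inf_coeff :: "'k cochain list \<Rightarrow> 'k::field_char_0 cochain" where
  "C_inf_coeff xs =
     (case xs of
        [] \<Rightarrow> 0
      | [(a, b, c), (a', b', c')] \<Rightarrow> (a * a', b * b', (a + b) / 2 * c' - c * ((a' + b') / 2))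
      | _ \<Rightarrow> (0, 0, C_inf_dt_part xs))"

definition C_inf :: "('k, 'k::field_char_0 cochain) ainf" where
  "C_inf = \<lparr> ainf_scale = cochain_scale, ainf_hom = cochain_hom, ainf_coeff = C_inf_coeff \<rparr>"

lemma C_inf_table_2:
  "C_inf_coeff [cochain_t, cochain_t] = cochain_t"
  "C_inf_coeff [cochain_t, cochain_dt] = (0, 0, 1 / 2)"
  "C_inf_coeff [cochain_dt, cochain_t] = (0, 0, - 1 / 2)"
  "C_inf_coeff [cochain_dt, cochain_dt] = 0"
  "C_inf_coeff [cochain_one, x] = x"
  "C_inf_coeff [(a, b, 0), cochain_one] = (a, b, 0)"
  "C_inf_coeff [(0, 0, c), cochain_one] = - (0, 0, c)"
  by (auto simp: C_inf_coeff_def zero_prod_def field_simps split: prod.splits)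

lemma C_inf_table_higher:
  assumes "n \<ge> 2" "i \<le> n"
  shows "C_inf_coeff (replicate i cochain_dt @ [cochain_t] @ replicate (n - i) cochain_dt) =
     (0, 0, (- 1) ^ (i + 1) * of_nat (n choose i) * bernoulli_coeff n)"
proof -
  let ?xs = "replicate i cochain_dt @ [cochain_t] @ replicate (n - i) cochain_dt :: 'a cochain list"
  have len: "length ?xs = n + 1" using assms by simp
  have nth: "?xs ! j = (if j = i then cochain_t else cochain_dt)" if "j \<le> n" for j
    using that assms by (auto simp: nth_append nth_Cons split: nat.splits)
  have "C_inf_coeff ?xs = (0, 0, C_inf_dt_part ?xs)"
  proof -
    have "C_inf_coeff ys = (0, 0, C_inf_dt_part ys)" if "length ys \<ge> 3" for ys :: "'a cochain list"
      using that by (auto simp: C_inf_coeff_def split: list.splits)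
    then show ?thesis using len assms by simp
  qed
  moreover have "C_inf_dt_part ?xs =
      (\<Sum>k\<le>n. if k = i then (- 1) ^ (i + 1) * of_nat (n choose i) * bernoulli_coeff n else 0)"
    unfolding C_inf_dt_part_def Let_def len
  proof (simp only: diff_add_inverse2, rule sum.cong[OF refl])
    fix k assume k: "k \<in> {..n}"
    have "(\<Prod>j\<in>{..n} - {i}. snd (snd (?xs ! j))) = (1 :: 'a)"
      by (rule prod.neutral) (use nth in auto)
    then show "(- 1) ^ (k + 1) * of_nat (n choose k) * bernoulli_coeff n *
        ((case ?xs ! k of (a, b, c) \<Rightarrow> a - b) * (\<Prod>j\<in>{..n} - {k}. snd (snd (?xs ! j)))) =
        (if k = i then (- 1) ^ (i + 1) * of_nat (n choose i) * bernoulli_coeff n else (0 :: 'a))"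
      using k nth[of k] by (cases "k = i") auto
  qed
  ultimately show ?thesis using assms by simp
qed


section \<open>The morphisms\<close>

text \<open>
  \<open>is_lambda \<Omega> S \<pi> I \<Lambda>\<close>: \<open>\<Lambda>\<close> is the A-infinity morphism from the forms \<open>\<Omega>\<close> with
  coefficient functions in \<open>S\<close> to the cup product algebra with first coefficient \<open>\<pi>\<close>, with
  higher coefficients vanishing on zero-forms, and with values on one-forms given by the
  iterated integral \<open>I\<close>.
\<close>

definition is_lambda ::
    "('k, 'f \<times> 'f::comm_ring) ainf \<Rightarrow> 'f set \<Rightarrow> ('f \<times> 'f \<Rightarrow> 'k cochain) \<Rightarrow> ('f list \<Rightarrow> 'k)
      \<Rightarrow> (('f \<times> 'f) list \<Rightarrow> 'k::field_char_0 cochain) \<Rightarrow> bool" where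
  "is_lambda \<Omega> S \<pi> I \<Lambda> \<longleftrightarrow>
     ainf_morphism \<Omega> C_cup \<Lambda> \<and>
     (\<forall>x\<in>ainf_carrier \<Omega>. \<Lambda> [x] = \<pi> x) \<and>
     (\<forall>xs. length xs > 1 \<longrightarrow> set xs \<subseteq> ainf_carrier \<Omega> \<longrightarrow> (\<exists>x\<in>set xs. x \<in> ainf_hom \<Omega> 0) \<longrightarrow>
        \<Lambda> xs = 0) \<and>
     (\<forall>as. length as \<ge> 1 \<longrightarrow> set as \<subseteq> S \<longrightarrow>
        \<Lambda> (map one_form as) = cochain_scale (I as) cochain_dt)"

definition is_lambda_smooth ::
    "(((real \<Rightarrow> real) \<times> (real \<Rightarrow> real)) list \<Rightarrow> real cochain) \<Rightarrow> bool" where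
  "is_lambda_smooth =
     is_lambda Omega_smooth smooth_funs
       (\<lambda>(f, a). (f 1, f 0, integral {0..1} a))
       (\<lambda>as. simplex_integral (length as) (\<lambda>t. \<Prod>i = 1..length as. (as ! (i - 1)) (t i)))"

definition is_lambda_poly ::
    "(('k poly \<times> 'k poly) list \<Rightarrow> 'k::field_char_0 cochain) \<Rightarrow> bool" where
  "is_lambda_poly =
     is_lambda Omega_poly UNIV
       (\<lambda>(f, a). (poly f 1, poly f 0, \<Sum>i\<le>degree a. coeff a i / of_nat (i + 1)))
       (\<lambda>as. formal_simplex_integral (length as)
          (\<Prod>i = 1..length as. poly_in_var i (as ! (i - 1))))"

definition is_log :: "('k::field_char_0 cochain list \<Rightarrow> 'k cochain) \<Rightarrow> bool" where
  "is_log L \<longleftrightarrow>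
     ainf_morphism C_cup C_inf L \<and>
     (\<forall>x. L [x] = x) \<and>
     (\<forall>xs. length xs > 1 \<longrightarrow> (\<exists>x\<in>set xs. x \<in> cochain_hom 0) \<longrightarrow> L xs = 0) \<and>
     (\<forall>n\<ge>1. L (replicate n cochain_dt) = cochain_scale ((- 1) ^ (n + 1) / of_nat n) cochain_dt)"

definition descent_number :: "nat \<Rightarrow> (nat \<Rightarrow> nat) \<Rightarrow> nat" where
  "descent_number n \<sigma> = card {i \<in> {1..n - 1}. \<sigma> i > \<sigma> (i + 1)}"

end

theory Submission
  imports Defs "HOL-Combinatorics.Multiset_Permutations"
begin

text \<open>
  By the composition formula, the coefficient \<open>\<phi>\<^sub>n\<close> on one-forms is the sum, over all divisions
  of \<open>a\<^sub>1, \<dots>, a\<^sub>n\<close> into \<open>k\<close> consecutive nonempty blocks, of \<open>(-1)\<^bsup>k+1\<^esup>/k\<close> times the product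
  of the iterated integrals of the blocks (\<open>log_lambda_one_forms\<close>). By the shuffle identity,
  such a product is the sum, over all permutations \<open>\<sigma>\<close> that increase along every block, of the
  integral of \<open>\<Prod>\<^sub>i a\<^sub>i(t\<^bsub>\<sigma> i\<^esub>)\<close> over the simplex: the product of the simplices of the
  blocks is cut up, up to a null set, by the order of all \<open>n\<close> variables.

  Exchanging the summations, the integral that belongs to \<open>\<sigma>\<close> receives the coefficient
  \<open>\<Sum> (-1)\<^bsup>k+1\<^esup>/k\<close> over all divisions with a cut at each of the \<open>d\<close> descents of \<open>\<sigma>\<close>. The
  \<open>n - 1 - d\<close> ascents may be cut or not, so this coefficient is
  \<open>(-1)\<^sup>d \<integral> x\<^sup>d (1 - x)\<^bsup>n-1-d\<^esup> dx\<close> over \<open>[0,1]\<close>, a Beta integral with the value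
  \<open>(-1)\<^sup>d d! (n-1-d)! / n!\<close>. This is the coefficient claimed (\<open>sum_monotone_blocks\<close>,
  \<open>sum_blocks_prod_eq_sum_permutes\<close>).

  The shuffle identity is proved once for both models of forms, from the identity
  \<open>P f \<cdot> P g = P (f \<cdot> P g) + P (P f \<cdot> g)\<close>, which integration by parts provides for the operator
  \<open>P\<close> of forming primitives (\<open>rota_baxter\<close>, \<open>nested_shuffle\<close>). It remains to recognise the
  integrals over simplices as iterated applications of \<open>P\<close>: by Fubini for smooth functions
  (\<open>integral_simplex_below\<close>), and monomial by monomial for the formal integrals
  (\<open>formal_primitive_eq_nested\<close>).

  If some input is a zero-form, every summand of the composition formula vanishes
  (\<open>log_lambda_zero_form\<close>).
\<close>

section \<open>Divisions of a list into blocks\<close>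

lemma blocks_Nil: "blocks [] = {[]}"
proof -
  have "bs = []" if "concat bs = []" "[] \<notin> set bs" for bs :: "'a list list"
    using that by (cases bs) auto
  then show ?thesis by (auto simp: blocks_def)
qed

lemma blocks_singleton: "blocks [x] = {[[x]]}"
proof -
  have "bs = [[x]]" if bs: "concat bs = [x]" "[] \<notin> set bs" for bs
  proof -
    from bs obtain bs' where "bs = [x] # bs'" "concat bs' = []" "[] \<notin> set bs'"
      by (cases bs) (auto simp: append_eq_Cons_conv)
    then show ?thesis by (cases bs') auto
  qed
  then show ?thesis by (auto simp: blocks_def)
qed

text \<open>
  The recursion behind every later summation over blocks: either there is a cut after the first
  letter, or there is none.
\<close>

lemma blocks_Cons_Cons:
  "blocks (x # y # ys) =
     (\<lambda>bs. [x] # bs) ` blocks (y # ys) \<union> (\<lambda>bs. (x # hd bs) # tl bs) ` blocks (y # ys)"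
  (is "?L = ?A \<union> ?B")
proof
  show "?L \<subseteq> ?A \<union> ?B"
  proof
    fix bs assume bs: "bs \<in> ?L"
    then obtain b bs' where bs_eq: "bs = (x # b) # bs'" and conc: "b @ concat bs' = y # ys"
      and ne: "[] \<notin> set bs'"
      by (cases bs) (auto simp: blocks_def append_eq_Cons_conv)
    show "bs \<in> ?A \<union> ?B"
    proof (cases "b = []")
      case True
      then have "bs \<in> ?A" using conc ne bs_eq by (auto simp: blocks_def)
      then show ?thesis ..
    next
      case False
      then have "b # bs' \<in> blocks (y # ys)" using conc ne by (auto simp: blocks_def)
      then have "bs \<in> ?B" using bs_eq by (intro image_eqI[of _ _ "b # bs'"]) auto
      then show ?thesis ..
    qed
  qed
next
  have "(x # hd bs) # tl bs \<in> ?L" if "bs \<in> blocks (y # ys)" for bs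
    using that by (cases bs) (auto simp: blocks_def)
  then show "?A \<union> ?B \<subseteq> ?L"
    by (auto simp: blocks_def)
qed

lemma finite_blocks: "finite (blocks xs)"
proof (induction xs rule: induct_list012)
  case (3 x y zs)
  then show ?case by (simp add: blocks_Cons_Cons)
qed (simp_all add: blocks_Nil blocks_singleton)

lemma blocks_Cons_cases:
  assumes "bs \<in> blocks (y # ys)"
  obtains b bs' where "bs = (y # b) # bs'"
  using assms by (cases bs) (auto simp: blocks_def append_eq_Cons_conv)

lemma sum_blocks_Cons_Cons:
  fixes g :: "'a list list \<Rightarrow> 'b::comm_monoid_add"
  shows "(\<Sum>bs\<in>blocks (x # y # ys). g bs) =
     (\<Sum>bs\<in>blocks (y # ys). g ([x] # bs)) + (\<Sum>bs\<in>blocks (y # ys). g ((x # hd bs) # tl bs))"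
proof -
  have inj: "inj_on (\<lambda>bs. (x # hd bs) # tl bs) (blocks (y # ys))"
    by (rule inj_onI) (auto elim!: blocks_Cons_cases)
  have "(\<Sum>bs\<in>blocks (x # y # ys). g bs) =
      sum g ((\<lambda>bs. [x] # bs) ` blocks (y # ys)) +
      sum g ((\<lambda>bs. (x # hd bs) # tl bs) ` blocks (y # ys))"
    unfolding blocks_Cons_Cons
    by (rule sum.union_disjoint) (auto simp: finite_blocks elim!: blocks_Cons_cases)
  then show ?thesis
    by (simp add: sum.reindex[OF inj] sum.reindex[of "\<lambda>bs. [x] # bs"] inj_on_def)
qed

lemma sum_blocks_map:
  fixes g :: "'b list list \<Rightarrow> 'c::comm_monoid_add"
  shows "(\<Sum>bs\<in>blocks (map f xs). g bs) = (\<Sum>bs\<in>blocks xs. g (map (map f) bs))"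
proof (induction xs arbitrary: g rule: induct_list012)
  case (3 x y zs)
  have "(\<Sum>bs\<in>blocks (map f (x # y # zs)). g bs) =
      (\<Sum>bs\<in>blocks (y # zs). g ([f x] # map (map f) bs)) +
      (\<Sum>bs\<in>blocks (y # zs). g ((f x # hd (map (map f) bs)) # tl (map (map f) bs)))"
    using "3.IH"(2)[of "\<lambda>bs. g ([f x] # bs)"]
      "3.IH"(2)[of "\<lambda>bs. g ((f x # hd bs) # tl bs)"]
    by (simp add: sum_blocks_Cons_Cons)
  also have "(\<Sum>bs\<in>blocks (y # zs). g ((f x # hd (map (map f) bs)) # tl (map (map f) bs))) =
      (\<Sum>bs\<in>blocks (y # zs). g (map (map f) ((x # hd bs) # tl bs)))"
    by (rule sum.cong) (auto elim!: blocks_Cons_cases)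
  finally show ?case by (simp add: sum_blocks_Cons_Cons)
qed (simp_all add: blocks_Nil blocks_singleton)

text \<open>
  When \<open>R i j\<close> means \<open>\<sigma> i < \<sigma> j\<close>, the breaks of the list \<open>1, \<dots>, n\<close> are the descents of
  \<open>\<sigma>\<close>. A division into \<open>R\<close>-increasing blocks has to cut at each of them.
\<close>

fun breaks :: "('a \<Rightarrow> 'a \<Rightarrow> bool) \<Rightarrow> 'a list \<Rightarrow> nat" where
  "breaks R (x # y # ys) = (if R x y then 0 else 1) + breaks R (y # ys)"
| "breaks R _ = 0"

lemma breaks_le: "xs \<noteq> [] \<Longrightarrow> breaks R xs < length xs"
  by (induction R xs rule: breaks.induct) auto

lemma breaks_upt:
  assumes "m \<le> n"
  shows "breaks R [m..<Suc n] = card {i \<in> {m..<n}. \<not> R i (Suc i)}"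
  using assms
proof (induction m rule: inc_induct)
  case (step m)
  have "{i \<in> {m..<n}. \<not> R i (Suc i)} =
      (if R m (Suc m) then {} else {m}) \<union> {i \<in> {Suc m..<n}. \<not> R i (Suc i)}"
    using step.hyps by (auto simp: le_less Suc_le_eq)
  then have "card {i \<in> {m..<n}. \<not> R i (Suc i)} =
      (if R m (Suc m) then 0 else 1) + card {i \<in> {Suc m..<n}. \<not> R i (Suc i)}"
    by (simp only:) (cases "R m (Suc m)"; simp)
  moreover have "[m..<Suc n] = m # Suc m # [Suc (Suc m)..<Suc n]" "[Suc m..<Suc n] = Suc m # [Suc (Suc m)..<Suc n]"
    using step.hyps by (simp_all add: upt_rec)
  ultimately show ?case using step.IH by simp
qed simp

text \<open>
  With \<open>p = m + breaks R xs\<close> and \<open>r\<close> the number of adjacent pairs of \<open>xs\<close> in \<open>R\<close>, the right-hand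
  side is \<open>(-1)\<^sup>p\<close> times the Beta integral \<open>\<integral> x\<^sup>p (1 - x)\<^sup>r dx = p! r! / (p + r + 1)!\<close> over
  \<open>[0,1]\<close>. The left-hand side is a binomial expansion of this integral: the
  shift and the forced cuts contribute \<open>(- x)\<^sup>p\<close>, and each remaining place may be cut or not,
  which contributes \<open>1 + (- x)\<close>. The logarithm needs
  only \<open>m = 0\<close>; the shift \<open>m\<close> is what makes the claim inductive, since detaching the first letter as
  a separate block raises the number of blocks by one. A forced cut gives the recursion
  \<open>p \<rightarrow> p + 1\<close>, and a pair in \<open>R\<close> gives the Beta recursion
  \<open>\<beta> (p, r) - \<beta> (p + 1, r) = \<beta> (p, r + 1)\<close>.
\<close>

lemma sum_monotone_blocks:
  fixes R :: "'a \<Rightarrow> 'a \<Rightarrow> bool"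
  assumes "transp R" "xs \<noteq> []"
  shows "(\<Sum>bs\<in>blocks xs. if \<forall>b\<in>set bs. sorted_wrt R b
            then (- 1) ^ (length bs + m + 1) / of_nat (length bs + m) else 0) =
         (- 1) ^ (m + breaks R xs) * fact (m + breaks R xs) * fact (length xs - 1 - breaks R xs)
            / (fact (m + length xs) :: 'k::field_char_0)"
  using assms(2)
proof (induction xs arbitrary: m rule: induct_list012)
  case (2 x)
  then show ?case by (simp add: blocks_singleton field_simps del: of_nat_Suc)
next
  case (3 x y zs)
  define W where "W m bs = (if \<forall>b\<in>set bs. sorted_wrt R b
      then (- 1) ^ (length bs + m + 1) / of_nat (length bs + m) else (0::'k))" for m bs
  let ?d = "breaks R (y # zs)"
  have IH: "(\<Sum>bs\<in>blocks (y # zs). W m bs) =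
      (- 1) ^ (m + ?d) * fact (m + ?d) * fact (length zs - ?d) / fact (Suc (m + length zs))" for m
    using "3.IH"(2)[of m] by (simp add: W_def del: breaks.simps fact_Suc)
  have "(\<Sum>bs\<in>blocks (y # zs). W m ([x] # bs)) = (\<Sum>bs\<in>blocks (y # zs). W (Suc m) bs)"
    by (intro sum.cong refl) (auto simp: W_def algebra_simps)
  moreover have "(\<Sum>bs\<in>blocks (y # zs). W m ((x # hd bs) # tl bs)) =
      (\<Sum>bs\<in>blocks (y # zs). if R x y then W m bs else 0)"
  proof (rule sum.cong[OF refl])
    fix bs assume "bs \<in> blocks (y # zs)"
    then obtain b bs' where bs: "bs = (y # b) # bs'" by (rule blocks_Cons_cases)
    have "sorted_wrt R (x # y # b) \<longleftrightarrow> R x y \<and> sorted_wrt R (y # b)"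
      using assms(1) by (auto dest: transpD)
    then show "W m ((x # hd bs) # tl bs) = (if R x y then W m bs else 0)"
      by (auto simp: W_def bs)
  qed
  ultimately have split: "(\<Sum>bs\<in>blocks (x # y # zs). W m bs) =
      (\<Sum>bs\<in>blocks (y # zs). W (Suc m) bs) + (if R x y then \<Sum>bs\<in>blocks (y # zs). W m bs else 0)"
    by (simp add: sum_blocks_Cons_Cons)
  have "(\<Sum>bs\<in>blocks (x # y # zs). W m bs) =
      (- 1) ^ (m + breaks R (x # y # zs)) * fact (m + breaks R (x # y # zs)) *
      fact (length (x # y # zs) - 1 - breaks R (x # y # zs)) / fact (m + length (x # y # zs))"
  proof (cases "R x y")
    case False
    then show ?thesis unfolding split IH by (simp del: fact_Suc)
  next
    case True
    obtain r where r: "length zs = ?d + r"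
      using breaks_le[of "y # zs" R] by (metis le_add_diff_inverse length_Cons less_Suc_eq_le list.distinct(1))
    define p where "p = m + ?d"
    \<comment> \<open>the Beta recursion, multiplied by the sign\<close>
    have key: "(- 1) ^ Suc p * fact (Suc p) * fact r / fact (Suc (Suc (p + r))) +
        (- 1) ^ p * fact p * fact r / fact (Suc (p + r)) =
        (- 1) ^ p * fact p * fact (Suc r) / (fact (Suc (Suc (p + r))) :: 'k)"
    proof -
      define q :: 'k where "q = of_nat (Suc (Suc (p + r)))"
      define F :: 'k where "F = fact (Suc (p + r))"
      have q: "q \<noteq> 0" "q = of_nat (Suc p) + of_nat (Suc r)" "F \<noteq> 0"
        by (simp_all add: q_def F_def del: of_nat_Suc fact_Suc) simp
      have F: "fact (Suc (Suc (p + r))) = q * F"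
        by (simp add: q_def F_def fact_Suc[of "Suc (p + r)"] del: fact_Suc of_nat_Suc)
      have "(- 1) ^ Suc p * fact (Suc p) * fact r + q * ((- 1) ^ p * fact p * fact r) =
          (- 1) ^ p * fact p * (fact (Suc r) :: 'k)"
        unfolding fact_Suc q(2) by (simp add: algebra_simps)
      moreover have "B / F = q * B / (q * F)" for B
        using q(1) by simp
      ultimately show ?thesis
        unfolding F F_def[symmetric] by (simp only: add_divide_distrib[symmetric])
    qed
    show ?thesis
      unfolding split IH using True key by (simp add: r p_def add.assoc del: fact_Suc)
  qed
  then show ?case by (simp only: W_def)
qed simp

section \<open>Interleavings of blocks\<close>

lemma mem_shuffles_iff:
  assumes "distinct us" "distinct vs" "set us \<inter> set vs = {}"
  shows "ws \<in> shuffles us vs \<longleftrightarrow> distinct ws \<and> set ws = set us \<union> set vs \<and>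
           filter (\<lambda>i. i \<in> set us) ws = us \<and> filter (\<lambda>i. i \<in> set vs) ws = vs"
proof
  assume "ws \<in> shuffles us vs"
  then show "distinct ws \<and> set ws = set us \<union> set vs \<and>
           filter (\<lambda>i. i \<in> set us) ws = us \<and> filter (\<lambda>i. i \<in> set vs) ws = vs"
    using assms distinct_disjoint_shuffles filter_shuffles_disjoint1(1) filter_shuffles_disjoint2(1)
      set_shuffles by metis
next
  assume *: "distinct ws \<and> set ws = set us \<union> set vs \<and>
           filter (\<lambda>i. i \<in> set us) ws = us \<and> filter (\<lambda>i. i \<in> set vs) ws = vs"
  then have "filter (\<lambda>i. i \<notin> set us) ws = filter (\<lambda>i. i \<in> set vs) ws"
    using assms(3) by (intro filter_cong) auto
  then show "ws \<in> shuffles us vs"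
    using partition_in_shuffles[of ws "\<lambda>i. i \<in> set us"] * by simp
qed

definition interleavings :: "'i list list \<Rightarrow> 'i list set" where
  "interleavings bs = {w \<in> permutations_of_set (set (concat bs)).
     \<forall>b\<in>set bs. filter (\<lambda>i. i \<in> set b) w = b}"

lemma finite_interleavings: "finite (interleavings bs)"
  by (simp add: interleavings_def)

text \<open>
  Deleting the letters of the first block does not disturb the order within the other blocks. The
  second part makes the union in the first one disjoint.
\<close>

lemma interleavings_Cons:
  assumes "distinct (concat (b # bs))"
  shows "interleavings (b # bs) = (\<Union>w\<in>interleavings bs. shuffles b w)"
    and "w \<in> interleavings bs \<Longrightarrow> ws \<in> shuffles b w \<Longrightarrow> w = filter (\<lambda>i. i \<notin> set b) ws"
proof -
  have disj: "distinct b" "set b \<inter> set (concat bs) = {}"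
    using assms by auto
  have w: "distinct w \<and> set w = set (concat bs)" if "w \<in> interleavings bs" for w
    using that by (simp add: interleavings_def permutations_of_set_def)
  have iff: "ws \<in> shuffles b w \<longleftrightarrow> distinct ws \<and> set ws = set b \<union> set w \<and>
       filter (\<lambda>i. i \<in> set b) ws = b \<and> filter (\<lambda>i. i \<in> set w) ws = w"
    if "w \<in> interleavings bs" for w ws
    by (rule mem_shuffles_iff) (use w[OF that] disj in auto)
  show fw: "w = filter (\<lambda>i. i \<notin> set b) ws"
    if "w \<in> interleavings bs" "ws \<in> shuffles b w" for w ws
  proof -
    have "filter (\<lambda>i. i \<in> set w) ws = filter (\<lambda>i. i \<notin> set b) ws"
      using iff[OF that(1)] that(2) w[OF that(1)] disj by (intro filter_cong) auto
    then show ?thesis using iff[OF that(1)] that(2) by simp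
  qed
  have sub: "filter (\<lambda>i. i \<in> set c) (filter (\<lambda>i. i \<notin> set b) ws) = filter (\<lambda>i. i \<in> set c) ws"
    if "c \<in> set bs" for c ws
    using that disj by (auto simp: intro!: filter_cong)
  show "interleavings (b # bs) = (\<Union>w\<in>interleavings bs. shuffles b w)"
  proof (intro set_eqI iffI)
    fix ws assume ws: "ws \<in> interleavings (b # bs)"
    let ?w = "filter (\<lambda>i. i \<notin> set b) ws"
    have W: "distinct ws" "set ws = set b \<union> set (concat bs)" "filter (\<lambda>i. i \<in> set b) ws = b"
      "\<And>c. c \<in> set bs \<Longrightarrow> filter (\<lambda>i. i \<in> set c) ws = c"
      using ws by (auto simp: interleavings_def permutations_of_set_def)
    have sw: "set ?w = set (concat bs)" using W(2) disj by auto
    have "?w \<in> interleavings bs"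
      using W sw sub by (simp add: interleavings_def permutations_of_set_def)
    moreover have "ws \<in> shuffles b ?w"
      using partition_in_shuffles[of ws "\<lambda>i. i \<in> set b"] W(3) by simp
    ultimately show "ws \<in> (\<Union>w\<in>interleavings bs. shuffles b w)" by blast
  next
    fix ws assume "ws \<in> (\<Union>w\<in>interleavings bs. shuffles b w)"
    then obtain w where ww: "w \<in> interleavings bs" "ws \<in> shuffles b w" by blast
    have "filter (\<lambda>i. i \<in> set c) ws = c" if "c \<in> set bs" for c
      using sub[OF that, of ws] fw[OF ww] ww(1) that by (simp add: interleavings_def)
    then show "ws \<in> interleavings (b # bs)"
      using iff[OF ww(1)] ww(2) w[OF ww(1)] by (auto simp: interleavings_def permutations_of_set_def)
  qed
qed

text \<open>
  The shuffle identity for two words, iterated over the blocks.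
\<close>

lemma prod_list_interleavings:
  fixes J :: "'i list \<Rightarrow> 'r::comm_semiring_1"
  assumes "J [] = 1"
    and shuffle: "\<And>us vs. distinct (us @ vs) \<Longrightarrow> J us * J vs = (\<Sum>ws\<in>shuffles us vs. J ws)"
    and "distinct (concat bs)"
  shows "(\<Prod>b\<leftarrow>bs. J b) = (\<Sum>w\<in>interleavings bs. J w)"
  using assms(3)
proof (induction bs)
  case Nil
  have "interleavings [] = {[] :: 'i list}" by (auto simp: interleavings_def)
  then show ?case using assms(1) by simp
next
  case (Cons b bs)
  have "(\<Prod>b\<leftarrow>b # bs. J b) = (\<Sum>w\<in>interleavings bs. J b * J w)"
    using Cons by (simp add: sum_distrib_left)
  also have "\<dots> = (\<Sum>w\<in>interleavings bs. \<Sum>ws\<in>shuffles b w. J ws)"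
    using Cons.prems
    by (intro sum.cong shuffle refl) (auto simp: interleavings_def permutations_of_set_def)
  also have "\<dots> = (\<Sum>ws\<in>(\<Union>w\<in>interleavings bs. shuffles b w). J ws)"
  proof (rule sum.UNION_disjoint[symmetric])
    show "\<forall>w\<in>interleavings bs. \<forall>w'\<in>interleavings bs.
        w \<noteq> w' \<longrightarrow> shuffles b w \<inter> shuffles b w' = {}"
      using interleavings_Cons(2)[OF Cons.prems] by (metis disjoint_iff)
  qed (simp_all add: finite_interleavings)
  finally show ?case by (simp add: interleavings_Cons(1)[OF Cons.prems])
qed

section \<open>Rota-Baxter operators and the shuffle identity\<close>

text \<open>
  A Rota-Baxter operator of weight zero. The identity for products is integration by parts for an
  operator that forms primitives. The carrier \<open>S\<close> restricts the operator to a ring of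
  integrands, such as the continuous functions, on which the identity is available.
\<close>

locale rota_baxter =
  fixes S :: "'r::comm_ring_1 set" and P :: "'r \<Rightarrow> 'r"
  assumes one_mem: "1 \<in> S"
    and add_mem: "f \<in> S \<Longrightarrow> g \<in> S \<Longrightarrow> f + g \<in> S"
    and mult_mem: "f \<in> S \<Longrightarrow> g \<in> S \<Longrightarrow> f * g \<in> S"
    and P_mem: "f \<in> S \<Longrightarrow> P f \<in> S"
    and P_add: "f \<in> S \<Longrightarrow> g \<in> S \<Longrightarrow> P (f + g) = P f + P g"
    and P_mult: "f \<in> S \<Longrightarrow> g \<in> S \<Longrightarrow> P f * P g = P (f * P g) + P (P f * g)"
begin

text \<open>
  The iterated integral, with the head of the list integrated last: for
  \<open>P f x = \<integral>\<^sub>0\<^sup>x f\<close>, \<open>nested [f\<^sub>n, \<dots>, f\<^sub>1] x\<close> is the integral of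
  \<open>f\<^sub>1(t\<^sub>1) \<dots> f\<^sub>n(t\<^sub>n)\<close> over \<open>0 \<le> t\<^sub>1 \<le> \<dots> \<le> t\<^sub>n \<le> x\<close>.
\<close>

definition nested :: "'r list \<Rightarrow> 'r" where
  "nested fs = foldr (\<lambda>f r. P (f * r)) fs 1"

lemma nested_simps [simp]:
  "nested [] = 1" "nested (f # fs) = P (f * nested fs)"
  by (simp_all add: nested_def)

lemma nested_mem: "set fs \<subseteq> S \<Longrightarrow> nested fs \<in> S"
  by (induction fs) (auto intro!: one_mem P_mem mult_mem)

lemma P_sum:
  assumes "finite W" "W \<noteq> {}" "\<And>w. w \<in> W \<Longrightarrow> f w \<in> S"
  shows "sum f W \<in> S \<and> P (sum f W) = (\<Sum>w\<in>W. P (f w))"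
  using assms by (induction W rule: finite_ne_induct) (auto simp: P_add add_mem)

text \<open>
  Ree's shuffle identity for iterated integrals. The product identity for \<open>P\<close> splits off the last
  integration variable of either factor, exactly as a shuffle of two nonempty words starts with the
  head of one or of the other. Distinctness of the letters makes these two cases disjoint, so that
  the set of shuffles counts each shuffle once.
\<close>

lemma nested_shuffle:
  assumes a: "range a \<subseteq> S" and "distinct (us @ vs)"
  shows "nested (map a us) * nested (map a vs) = (\<Sum>ws\<in>shuffles us vs. nested (map a ws))"
  using assms(2)
proof (induction us vs rule: shuffles.induct)
  case (3 x xs y ys)
  have a_mem: "a i \<in> S" and mem: "nested (map a w) \<in> S" for i w
    using a by (auto intro!: nested_mem simp: image_subset_iff)
  have P_shuffles: "P (a z * (\<Sum>ws\<in>shuffles us vs. nested (map a ws))) =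
      (\<Sum>ws\<in>(#) z ` shuffles us vs. nested (map a ws))" for z us vs
  proof -
    have "shuffles us vs \<noteq> {}" using splice_in_shuffles by blast
    then have "P (\<Sum>ws\<in>shuffles us vs. a z * nested (map a ws)) =
        (\<Sum>ws\<in>shuffles us vs. P (a z * nested (map a ws)))"
      by (intro conjunct2[OF P_sum]) (auto intro: mult_mem mem a_mem)
    then show ?thesis by (simp add: sum_distrib_left sum.reindex)
  qed
  let ?x = "nested (map a xs)" and ?y = "nested (map a ys)"
  let ?xx = "nested (map a (x # xs))" and ?yy = "nested (map a (y # ys))"
  have "?xx * ?yy = P (a x * ?x) * P (a y * ?y)" by simp
  also have "\<dots> = P (a x * ?x * P (a y * ?y)) + P (P (a x * ?x) * (a y * ?y))"
    by (rule P_mult) (auto intro: mult_mem mem a_mem)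
  also have "\<dots> = P (a x * (?x * ?yy)) + P (a y * (?xx * ?y))"
    by (simp add: mult_ac)
  also have "\<dots> = P (a x * (\<Sum>ws\<in>shuffles xs (y # ys). nested (map a ws))) +
      P (a y * (\<Sum>ws\<in>shuffles (x # xs) ys. nested (map a ws)))"
    using 3 by (simp only: distinct_append) simp
  also have "\<dots> = (\<Sum>ws\<in>(#) x ` shuffles xs (y # ys). nested (map a ws)) +
      (\<Sum>ws\<in>(#) y ` shuffles (x # xs) ys. nested (map a ws))"
    by (simp only: P_shuffles)
  also have "\<dots> = (\<Sum>ws\<in>shuffles (x # xs) (y # ys). nested (map a ws))"
    using "3.prems" by (subst sum.union_disjoint[symmetric]) auto
  finally show ?case .
qed simp_all

end

lemma shuffles_rev:
  assumes "distinct (us @ vs)"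
  shows "shuffles (rev us) (rev vs) = rev ` shuffles us vs"
proof -
  have "ws \<in> shuffles (rev us) (rev vs) \<longleftrightarrow> rev ws \<in> shuffles us vs" for ws
  proof -
    have "ws \<in> shuffles (rev us) (rev vs) \<longleftrightarrow> distinct ws \<and> set ws = set us \<union> set vs \<and>
        filter (\<lambda>i. i \<in> set us) ws = rev us \<and> filter (\<lambda>i. i \<in> set vs) ws = rev vs"
      using assms by (subst mem_shuffles_iff) auto
    also have "\<dots> \<longleftrightarrow> rev ws \<in> shuffles us vs"
      using assms by (subst mem_shuffles_iff) (auto simp: rev_filter[symmetric] rev_swap)
    finally show ?thesis .
  qed
  then show ?thesis by (metis (no_types, lifting) image_iff rev_rev_ident subsetI subset_antisym)
qed

text \<open>
  The simplex is parametrised in increasing order, whereas \<open>nested\<close> begins with the largest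
  variable. Reversal of words turns one into the other and is compatible with shuffles.
\<close>

lemma (in rota_baxter) eval_nested_rev_shuffle:
  fixes eval :: "'r \<Rightarrow> 'k::comm_ring_1"
  assumes "\<And>f g. eval (f + g) = eval f + eval g" "\<And>f g. eval (f * g) = eval f * eval g"
    and a: "range a \<subseteq> S" and dist: "distinct (us @ vs)"
  shows "eval (nested (rev (map a us))) * eval (nested (rev (map a vs))) =
    (\<Sum>ws\<in>shuffles us vs. eval (nested (rev (map a ws))))"
proof -
  have eval_sum: "finite W \<Longrightarrow> W \<noteq> {} \<Longrightarrow> eval (sum f W) = (\<Sum>w\<in>W. eval (f w))" for f and W :: "'i list set"
    by (induction W rule: finite_ne_induct) (simp_all add: assms(1))
  have "nested (rev (map a us)) * nested (rev (map a vs)) =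
      (\<Sum>ws\<in>shuffles us vs. nested (rev (map a ws)))"
    using nested_shuffle[OF a, of "rev us" "rev vs"] dist
    by (simp add: shuffles_rev[OF dist] sum.reindex rev_map Int_commute)
  moreover have "shuffles us vs \<noteq> {}" using splice_in_shuffles by blast
  ultimately show ?thesis by (simp add: assms(2)[symmetric] eval_sum)
qed

section \<open>Permutations and their descents\<close>

text \<open>
  The word attached to \<open>\<sigma>\<close> is the one in which the letter \<open>i\<close> stands at place \<open>\<sigma> i\<close>: it lists the
  integrands in the order of their variables when \<open>a\<^sub>i\<close> is evaluated at \<open>t\<^bsub>\<sigma> i\<^esub>\<close>.
\<close>

lemma bij_permutes_words:
  "bij_betw (\<lambda>\<sigma>. map (inv \<sigma>) [1..<Suc n]) {\<sigma>. \<sigma> permutes {1..n}} (permutations_of_set {1..n})"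
  (is "bij_betw ?f ?P ?W")
proof -
  have inj: "inj_on ?f ?P"
  proof (rule inj_onI)
    fix \<sigma> \<tau> assume st: "\<sigma> \<in> ?P" "\<tau> \<in> ?P" "?f \<sigma> = ?f \<tau>"
    have "inv \<sigma> i = inv \<tau> i" for i
    proof (cases "i \<in> {1..n}")
      case True
      then show ?thesis using st(3) by (auto simp del: upt_Suc)
    next
      case False
      then show ?thesis using st(1,2) permutes_inv permutes_not_in by (metis mem_Collect_eq)
    qed
    then have "inv \<sigma> = inv \<tau>" by blast
    then show "\<sigma> = \<tau>" using st(1,2) by (metis mem_Collect_eq permutes_inv_inv)
  qed
  have sub: "?f ` ?P \<subseteq> ?W"
  proof
    fix w assume "w \<in> ?f ` ?P"
    then obtain \<sigma> where s: "\<sigma> permutes {1..n}" "w = ?f \<sigma>" by blast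
    have "set w = inv \<sigma> ` {1..n}"
      unfolding s(2) set_map by (auto simp del: upt_Suc)
    moreover have "distinct w"
      using permutes_inj[OF permutes_inv[OF s(1)]] by (simp add: s(2) distinct_map inj_on_def inj_def del: upt_Suc)
    ultimately show "w \<in> ?W"
      using permutes_image[OF permutes_inv[OF s(1)]] by (simp add: permutations_of_set_def)
  qed
  have "card (?f ` ?P) = card ?W"
    using card_image[OF inj] by (simp add: card_permutations)
  then have "?f ` ?P = ?W" using sub by (intro card_subset_eq) auto
  then show ?thesis using inj by (simp add: bij_betw_def)
qed

lemma prod_permutes_eq:
  assumes "\<sigma> permutes {1..n}"
  shows "(\<Prod>i = 1..n. h (a i) (\<sigma> i)) =
    (\<Prod>j = 1..n. h (map a (map (inv \<sigma>) [1..<Suc n]) ! (j - 1)) j :: 'r::comm_monoid_mult)"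
proof -
  have "(\<Prod>j = 1..n. h (map a (map (inv \<sigma>) [1..<Suc n]) ! (j - 1)) j) =
      (\<Prod>j = 1..n. h (a (inv \<sigma> j)) j)"
    by (rule prod.cong) (auto simp del: upt_Suc)
  also have "\<dots> = (\<Prod>i = 1..n. h (a (inv \<sigma> (\<sigma> i))) (\<sigma> i))"
    using prod.permute[OF assms, of "\<lambda>j. h (a (inv \<sigma> j)) j"] by (simp add: comp_def)
  finally show ?thesis by (simp add: permutes_inverses[OF assms])
qed

text \<open>
  The letters of \<open>b\<close> occur in the word of \<open>\<sigma>\<close> in the order of their places \<open>\<sigma> i\<close>, so they occur in
  the order of \<open>b\<close> precisely when \<open>\<sigma>\<close> increases along \<open>b\<close>.
\<close>

lemma filter_eq_iff_sorted:
  assumes \<sigma>: "\<sigma> permutes {1..n}" and b: "set b \<subseteq> {1..n}"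
  shows "filter (\<lambda>i. i \<in> set b) (map (inv \<sigma>) [1..<Suc n]) = b \<longleftrightarrow> sorted_wrt (\<lambda>i j. \<sigma> i < \<sigma> j) b"
    (is "?v = b \<longleftrightarrow> _")
proof -
  have "sorted_wrt (\<lambda>i j. \<sigma> i < \<sigma> j) (map (inv \<sigma>) [1..<Suc n])"
    unfolding sorted_wrt_map permutes_inverses[OF \<sigma>] by (rule sorted_wrt_upt)
  then have sv: "sorted_wrt (\<lambda>i j. \<sigma> i < \<sigma> j) ?v" by (rule sorted_wrt_filter)
  have "inv \<sigma> ` {1..n} = {1..n}" by (rule permutes_image[OF permutes_inv[OF \<sigma>]])
  then have set_v: "set ?v = set b"
    using b by (auto simp: atLeastLessThanSuc_atLeastAtMost simp del: upt_Suc)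
  show ?thesis
  proof
    assume "?v = b"
    then show "sorted_wrt (\<lambda>i j. \<sigma> i < \<sigma> j) b" using sv by simp
  next
    assume sb: "sorted_wrt (\<lambda>i j. \<sigma> i < \<sigma> j) b"
    have "map \<sigma> ?v = map \<sigma> b"
      by (rule strict_sorted_equal) (use sv sb set_v in \<open>simp_all add: sorted_wrt_map del: upt_Suc\<close>)
    then show "?v = b" using permutes_inj[OF \<sigma>] by (simp only: inj_map_eq_map)
  qed
qed

text \<open>
  The word of \<open>\<sigma>\<close> interleaves the blocks of a division iff \<open>\<sigma>\<close> increases along every block, so the
  sum is a Beta integral, with \<open>d\<close> descents and \<open>n - 1 - d\<close> ascents.
\<close>

lemma sum_blocks_log_coeff:
  assumes \<sigma>: "\<sigma> permutes {1..n}" and n: "n \<ge> 1"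
  shows "(\<Sum>bs\<in>blocks [1..<Suc n]. if map (inv \<sigma>) [1..<Suc n] \<in> interleavings bs
            then (- 1) ^ (length bs + 1) / of_nat (length bs) else 0) =
         (1 / of_nat n * ((- 1) ^ descent_number n \<sigma> / of_nat ((n - 1) choose descent_number n \<sigma>)) :: 'k::field_char_0)"
proof -
  let ?R = "\<lambda>i j. \<sigma> i < \<sigma> j" and ?xs = "[1..<Suc n]"
  have "descent_number n \<sigma> = card {i \<in> {1..<n}. \<not> \<sigma> i < \<sigma> (Suc i)}"
  proof -
    have "\<sigma> (Suc i) \<noteq> \<sigma> i" for i using permutes_inj[OF \<sigma>] by (metis injD n_not_Suc_n)
    then have "(\<sigma> (Suc i) < \<sigma> i) = (\<not> \<sigma> i < \<sigma> (Suc i))" for i by (metis linorder_neqE_nat order.asym)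
    moreover have "{1..n - 1} = {1..<n}" using n by auto
    ultimately show ?thesis by (simp add: descent_number_def)
  qed
  then have breaks: "breaks ?R ?xs = descent_number n \<sigma>"
    using breaks_upt[OF n, of ?R] by (simp del: upt_Suc)
  have "map (inv \<sigma>) ?xs \<in> interleavings bs \<longleftrightarrow> (\<forall>b\<in>set bs. sorted_wrt ?R b)"
    if bs: "bs \<in> blocks ?xs" for bs
  proof -
    have c: "concat bs = ?xs" using bs by (simp add: blocks_def)
    then have c': "set (concat bs) = {1..n}" by (auto simp del: upt_Suc)
    have "map (inv \<sigma>) ?xs \<in> permutations_of_set {1..n}"
      using bij_betwE[OF bij_permutes_words[of n]] \<sigma> by blast
    moreover have "set b \<subseteq> {1..n}" if "b \<in> set bs" for b
      using c' that by auto
    ultimately show ?thesis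
      unfolding interleavings_def c' using filter_eq_iff_sorted[OF \<sigma>] by (auto simp del: upt_Suc)
  qed
  then have "(\<Sum>bs\<in>blocks ?xs. if map (inv \<sigma>) ?xs \<in> interleavings bs
            then (- 1) ^ (length bs + 1) / of_nat (length bs) else (0::'k)) =
      (\<Sum>bs\<in>blocks ?xs. if \<forall>b\<in>set bs. sorted_wrt ?R b
            then (- 1) ^ (length bs + 0 + 1) / of_nat (length bs + 0) else 0)"
    by (intro sum.cong) (auto simp del: upt_Suc)
  also have "\<dots> = (- 1) ^ (0 + breaks ?R ?xs) * fact (0 + breaks ?R ?xs) *
      fact (length ?xs - 1 - breaks ?R ?xs) / (fact (0 + length ?xs))"
    by (rule sum_monotone_blocks) (use n in \<open>auto intro!: transpI\<close>)
  also have "\<dots> = (- 1) ^ descent_number n \<sigma> *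
      (fact (descent_number n \<sigma>) * fact (n - 1 - descent_number n \<sigma>) / fact n)"
    by (simp add: breaks del: upt_Suc One_nat_def)
  also have "fact (descent_number n \<sigma>) * fact (n - 1 - descent_number n \<sigma>) / fact n =
      1 / (of_nat n * of_nat ((n - 1) choose descent_number n \<sigma>) :: 'k)"
  proof -
    have "descent_number n \<sigma> \<le> n - 1"
      unfolding descent_number_def by (rule order.trans[OF card_mono[of "{1..n-1}"]]) auto
    then have "of_nat ((n - 1) choose descent_number n \<sigma>) =
        (fact (n - 1) / (fact (descent_number n \<sigma>) * fact (n - 1 - descent_number n \<sigma>)) :: 'k)"
      by (rule binomial_fact)
    moreover have "fact n = (of_nat n * fact (n - 1) :: 'k)" using n by (simp add: fact_reduce)
    ultimately show ?thesis by (simp only:) simp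
  qed
  finally show ?thesis by simp
qed

text \<open>
  Each product over blocks expands into interleavings; after exchanging the summations, the
  coefficient of the word of \<open>\<sigma>\<close> depends only on the descents of \<open>\<sigma>\<close>.
\<close>

lemma sum_blocks_prod_eq_sum_permutes:
  fixes J :: "nat list \<Rightarrow> 'k::field_char_0"
  assumes "J [] = 1"
    and "\<And>us vs. distinct (us @ vs) \<Longrightarrow> J us * J vs = (\<Sum>ws\<in>shuffles us vs. J ws)"
    and n: "n \<ge> 1"
  shows "(\<Sum>bs\<in>blocks [1..<Suc n]. (- 1) ^ (length bs + 1) / of_nat (length bs) * (\<Prod>b\<leftarrow>bs. J b)) =
     (\<Sum>\<sigma> | \<sigma> permutes {1..n}.
        1 / of_nat n * ((- 1) ^ descent_number n \<sigma> / of_nat ((n - 1) choose descent_number n \<sigma>)) *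
        J (map (inv \<sigma>) [1..<Suc n]))"
proof -
  let ?xs = "[1..<Suc n]" and ?W = "permutations_of_set {1..n}"
  define c :: "nat list list \<Rightarrow> 'k" where "c bs = (- 1) ^ (length bs + 1) / of_nat (length bs)" for bs
  have "(\<Sum>bs\<in>blocks ?xs. c bs * (\<Prod>b\<leftarrow>bs. J b)) =
      (\<Sum>bs\<in>blocks ?xs. \<Sum>w\<in>?W. if w \<in> interleavings bs then c bs * J w else 0)"
  proof (rule sum.cong[OF refl])
    fix bs assume bs: "bs \<in> blocks ?xs"
    then have conc: "concat bs = ?xs" by (simp add: blocks_def)
    then have "distinct (concat bs)" by (simp del: upt_Suc)
    then have "(\<Prod>b\<leftarrow>bs. J b) = (\<Sum>w\<in>interleavings bs. J w)"
      by (intro prod_list_interleavings assms(1,2))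
    moreover have "interleavings bs \<subseteq> ?W"
    proof -
      have "set (concat bs) = {1..n}" unfolding conc by auto
      then show ?thesis by (auto simp: interleavings_def)
    qed
    ultimately show "c bs * (\<Prod>b\<leftarrow>bs. J b) =
        (\<Sum>w\<in>?W. if w \<in> interleavings bs then c bs * J w else 0)"
      by (simp add: sum_distrib_left sum.If_cases Int_absorb1)
  qed
  also have "\<dots> = (\<Sum>w\<in>?W. \<Sum>bs\<in>blocks ?xs. if w \<in> interleavings bs then c bs * J w else 0)"
    by (rule sum.swap)
  also have "\<dots> = (\<Sum>w\<in>?W. (\<Sum>bs\<in>blocks ?xs. if w \<in> interleavings bs then c bs else 0) * J w)"
    by (simp add: sum_distrib_right if_distrib[of "\<lambda>x. x * _"] del: upt_Suc cong: if_cong)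
  also have "\<dots> = (\<Sum>\<sigma> | \<sigma> permutes {1..n}.
      (\<Sum>bs\<in>blocks ?xs. if map (inv \<sigma>) ?xs \<in> interleavings bs then c bs else 0) * J (map (inv \<sigma>) ?xs))"
    by (rule sum.reindex_bij_betw[OF bij_permutes_words, symmetric])
  finally show ?thesis
    unfolding c_def using sum_blocks_log_coeff[OF _ n, where 'k = 'k] by (simp del: upt_Suc)
qed

section \<open>Taylor coefficients of the composite\<close>

lemma ainf_carrier_C_cup: "ainf_carrier C_cup = (UNIV :: 'k::field_char_0 cochain set)"
proof -
  have "x \<in> ainf_carrier C_cup" for x :: "'k cochain"
  proof -
    obtain a b c where x: "x = (a, b, c)" by (cases x)
    define h :: "int \<Rightarrow> 'k cochain" where "h d = (if d = 0 then (a, b, 0) else (0, 0, c))" for d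
    have "x = (\<Sum>d\<in>{0, 1}. h d)" by (simp add: h_def x)
    moreover have "\<forall>d\<in>{0, 1}. h d \<in> ainf_hom C_cup d"
      by (auto simp: C_cup_def cochain_hom_def h_def)
    ultimately show ?thesis unfolding ainf_carrier_def by blast
  qed
  then show ?thesis by blast
qed

lemma cochain_scale_scale: "cochain_scale r (cochain_scale s x) = cochain_scale (r * s) x"
  by (cases x) (simp add: cochain_scale_def mult.assoc)

text \<open>
  By multilinearity the coefficients come out one at a time, which leaves a list of copies of
  \<open>dt\<close>. In the induction \<open>m\<close> counts the arguments already replaced by \<open>dt\<close>.
\<close>

lemma log_multiples_of_dt:
  fixes L :: "'k::field_char_0 cochain list \<Rightarrow> 'k cochain"
  assumes L: "is_log L" and "cs \<noteq> []"
  shows "L (map (\<lambda>c. cochain_scale c cochain_dt) cs) =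
    cochain_scale ((- 1) ^ (length cs + 1) / of_nat (length cs) * prod_list cs) cochain_dt"
proof -
  have "multilinear_coeffs C_cup C_inf L"
    using L by (simp add: is_log_def ainf_morphism_def)
  then have scale: "L (us @ cochain_scale c x # ws) = cochain_scale c (L (us @ x # ws))" for us ws c x
  proof -
    have "L (us @ [ainf_scale C_cup c x] @ ws) = ainf_scale C_inf c (L (us @ [x] @ ws))"
      using \<open>multilinear_coeffs C_cup C_inf L\<close>
      unfolding multilinear_coeffs_def ainf_carrier_C_cup by blast
    then show ?thesis by (simp add: C_cup_def C_inf_def)
  qed
  have "L (replicate m cochain_dt @ map (\<lambda>c. cochain_scale c cochain_dt) cs) =
      cochain_scale (prod_list cs) (L (replicate (m + length cs) cochain_dt))" for m
  proof (induction cs arbitrary: m)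
    case Nil
    show ?case by (cases "L (replicate m cochain_dt)") (simp add: cochain_scale_def)
  next
    case (Cons c cs)
    have "replicate m cochain_dt @ cochain_dt # ws = replicate (Suc m) cochain_dt @ ws"
      for ws :: "'k cochain list"
      by (simp add: replicate_app_Cons_same)
    note shift = this
    have "L (replicate m cochain_dt @ map (\<lambda>c. cochain_scale c cochain_dt) (c # cs)) =
        cochain_scale c (L (replicate (Suc m) cochain_dt @ map (\<lambda>c. cochain_scale c cochain_dt) cs))"
      by (simp only: list.map scale shift)
    then show ?case by (simp only: Cons cochain_scale_scale prod_list.Cons) simp
  qed
  from this[of 0] show ?thesis
    using L \<open>cs \<noteq> []\<close> by (simp add: is_log_def cochain_scale_scale mult.commute Suc_le_eq)
qed

text \<open>
  The block that contains the zero-form \<open>x\<close> is sent to a cochain of degree zero: to \<open>\<pi> x\<close> if \<open>x\<close> is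
  alone in it, and to \<open>0\<close> otherwise. With at least two blocks the logarithm vanishes because of this
  argument; a single block has at least two letters and already maps to \<open>0\<close>.
\<close>

lemma log_lambda_zero_form:
  fixes L :: "'k::field_char_0 cochain list \<Rightarrow> 'k cochain"
  assumes lam: "is_lambda \<Omega> S \<pi> I \<Lambda>" and L: "is_log L"
    and \<pi>: "\<And>x. x \<in> ainf_hom \<Omega> 0 \<Longrightarrow> \<pi> x \<in> cochain_hom 0"
    and xs: "length xs \<ge> 2" "set xs \<subseteq> ainf_carrier \<Omega>" "x \<in> set xs" "x \<in> ainf_hom \<Omega> 0"
  shows "ainf_comp L \<Lambda> xs = 0"
  unfolding ainf_comp_def
proof (rule sum.neutral, rule ballI)
  fix bs assume bs: "bs \<in> blocks xs"
  then have conc: "concat bs = xs" "[] \<notin> set bs" by (auto simp: blocks_def)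
  then obtain b where b: "b \<in> set bs" "x \<in> set b" using xs(3) by (metis UN_E set_concat)
  have zero: "(0::'k cochain) \<in> cochain_hom 0" by (auto simp: cochain_hom_def zero_prod_def)
  have carrier: "set b \<subseteq> ainf_carrier \<Omega>" using b(1) xs(2) unfolding conc(1)[symmetric] set_concat by blast
  have \<Lambda>b: "\<Lambda> b = 0" if "length b > 1"
    using lam that carrier b(2) xs(4) unfolding is_lambda_def by blast
  have "\<Lambda> b \<in> cochain_hom 0"
  proof (cases "length b > 1")
    case True
    then show ?thesis using \<Lambda>b zero by simp
  next
    case False
    then have "b = [x]" using b(2) by (cases b) auto
    then show ?thesis using lam carrier \<pi>[OF xs(4)] by (simp add: is_lambda_def)
  qed
  show "L (map \<Lambda> bs) = 0"
  proof (cases "length bs > 1")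
    case True
    moreover have "\<exists>y\<in>set (map \<Lambda> bs). y \<in> cochain_hom 0"
      using b(1) \<open>\<Lambda> b \<in> cochain_hom 0\<close> by auto
    ultimately show ?thesis using L by (simp add: is_log_def)
  next
    case False
    then have "bs = [b]" using b(1) by (cases bs) auto
    moreover have "length b > 1" using xs(1) conc(1) \<open>bs = [b]\<close> by simp
    ultimately have "map \<Lambda> bs = [0]" using \<Lambda>b by simp
    then show ?thesis using L by (simp only: is_log_def)
  qed
qed

text \<open>
  The composition formula turns the coefficient into a weighted sum, over the divisions into blocks,
  of products of iterated integrals; the shuffle identity for \<open>I\<close> expands these products.
\<close>

lemma log_lambda_one_forms:
  fixes I :: "'f::comm_ring list \<Rightarrow> 'k::field_char_0"
  assumes lam: "is_lambda \<Omega> S \<pi> I \<Lambda>" and L: "is_log L"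
    and a: "range a \<subseteq> S" and n: "n \<ge> 1"
    and I_Nil: "I [] = 1"
    and shuffle: "\<And>us vs. distinct (us @ vs) \<Longrightarrow>
      I (map a us) * I (map a vs) = (\<Sum>ws\<in>shuffles us vs. I (map a ws))"
  shows "ainf_comp L \<Lambda> (map one_form (map a [1..<Suc n])) =
    cochain_scale (\<Sum>\<sigma> | \<sigma> permutes {1..n}.
        1 / of_nat n * ((- 1) ^ descent_number n \<sigma> / of_nat ((n - 1) choose descent_number n \<sigma>)) *
        I (map a (map (inv \<sigma>) [1..<Suc n]))) cochain_dt"
proof -
  let ?J = "\<lambda>w. I (map a w)"
  have \<Lambda>: "\<Lambda> (map one_form as) = cochain_scale (I as) cochain_dt" if "as \<noteq> []" "set as \<subseteq> S" for as
    using lam that by (simp add: is_lambda_def Suc_le_eq)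
  have "ainf_comp L \<Lambda> (map one_form (map a [1..<Suc n])) =
      (\<Sum>bs\<in>blocks [1..<Suc n]. L (map \<Lambda> (map (map (\<lambda>i. one_form (a i))) bs)))"
    by (simp add: ainf_comp_def sum_blocks_map comp_def del: upt_Suc)
  also have "\<dots> = (\<Sum>bs\<in>blocks [1..<Suc n].
      cochain_scale ((- 1) ^ (length bs + 1) / of_nat (length bs) * (\<Prod>b\<leftarrow>bs. ?J b)) cochain_dt)"
  proof (rule sum.cong[OF refl])
    fix bs assume bs: "bs \<in> blocks [1..<Suc n]"
    have "\<Lambda> (map (\<lambda>i. one_form (a i)) b) = cochain_scale (?J b) cochain_dt" if "b \<in> set bs" for b
    proof -
      have "b \<noteq> []" using that bs by (auto simp: blocks_def)
      then show ?thesis using \<Lambda>[of "map a b"] a by (auto simp: comp_def)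
    qed
    then have "map \<Lambda> (map (map (\<lambda>i. one_form (a i))) bs) =
        map (\<lambda>c. cochain_scale c cochain_dt) (map ?J bs)"
      by simp
    moreover have "bs \<noteq> []" using bs n by (auto simp: blocks_def)
    ultimately show "L (map \<Lambda> (map (map (\<lambda>i. one_form (a i))) bs)) =
      cochain_scale ((- 1) ^ (length bs + 1) / of_nat (length bs) * (\<Prod>b\<leftarrow>bs. ?J b)) cochain_dt"
      using log_multiples_of_dt[OF L, of "map ?J bs"] by (simp only: length_map map_is_Nil_conv not_False_eq_True)
  qed
  also have "\<dots> = cochain_scale (\<Sum>bs\<in>blocks [1..<Suc n].
      (- 1) ^ (length bs + 1) / of_nat (length bs) * (\<Prod>b\<leftarrow>bs. ?J b)) cochain_dt"
  proof -
    have "(\<Sum>x\<in>X. cochain_scale (h x) cochain_dt) = cochain_scale (\<Sum>x\<in>X. h x) cochain_dt"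
      for X and h :: "nat list list \<Rightarrow> 'k"
      by (induction X rule: infinite_finite_induct) (simp_all add: cochain_scale_def zero_prod_def)
    then show ?thesis .
  qed
  also have "(\<Sum>bs\<in>blocks [1..<Suc n]. (- 1) ^ (length bs + 1) / of_nat (length bs) * (\<Prod>b\<leftarrow>bs. ?J b)) =
     (\<Sum>\<sigma> | \<sigma> permutes {1..n}.
        1 / of_nat n * ((- 1) ^ descent_number n \<sigma> / of_nat ((n - 1) choose descent_number n \<sigma>)) *
        ?J (map (inv \<sigma>) [1..<Suc n]))"
    by (rule sum_blocks_prod_eq_sum_permutes[OF _ shuffle n]) (simp_all add: I_Nil)
  finally show ?thesis .
qed

section \<open>Smooth forms\<close>

text \<open>
  The value \<open>0\<close> outside \<open>[0,1]\<close> makes the Rota-Baxter identity an equality of functions on the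
  whole real line, although the integrands are controlled on \<open>[0,1]\<close> only.
\<close>

definition primitive :: "(real \<Rightarrow> real) \<Rightarrow> real \<Rightarrow> real" where
  "primitive f x = (if x \<in> {0..1} then integral {0..x} f else 0)"

interpretation smooth: rota_baxter "{f. continuous_on {0..1::real} f}" primitive
proof
  fix f g :: "real \<Rightarrow> real"
  assume f: "f \<in> {f. continuous_on {0..1} f}" and g: "g \<in> {f. continuous_on {0..1} f}"
  have cont: "continuous_on {0..1} (primitive h)" if "continuous_on {0..1} h" for h
    unfolding primitive_def
    by (subst continuous_on_cong[OF refl])
      (auto intro!: indefinite_integral_continuous_1 integrable_continuous_real that)
  then show "primitive f \<in> {f. continuous_on {0..1} f}" using f by simp
  show "f + g \<in> {f. continuous_on {0..1} f}" "f * g \<in> {f. continuous_on {0..1} f}"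
    using f g by (auto simp: plus_fun_def times_fun_def intro!: continuous_intros)
  have int: "h integrable_on {0..x}" if "continuous_on {0..1} h" "x \<in> {0..1}" for h :: "real \<Rightarrow> real" and x
    using that by (intro integrable_continuous_real) (auto elim: continuous_on_subset)
  have add: "primitive (h + k) = primitive h + primitive k"
    if "continuous_on {0..1} h" "continuous_on {0..1} k" for h k
    using that by (auto simp: fun_eq_iff primitive_def plus_fun_def int intro!: integral_add)
  then show "primitive (f + g) = primitive f + primitive g"
    using f g by blast
  have "primitive f x * primitive g x = primitive (f * primitive g + primitive f * g) x"
    if x: "x \<in> {0..1}" for x
  proof -
    have deriv: "(primitive h has_vector_derivative h u) (at u within {0..x})"
      if h: "continuous_on {0..1} h" and u: "u \<in> {0..x}" for h u
    proof (rule has_vector_derivative_transform)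
      show "((\<lambda>u. integral {0..u} h) has_vector_derivative h u) (at u within {0..x})"
        using x u by (intro integral_has_vector_derivative continuous_on_subset[OF h]) auto
    qed (use x u in \<open>auto simp: primitive_def\<close>)
    \<comment> \<open>the product rule, integrated from \<open>0\<close> to \<open>x\<close>\<close>
    have "((f * primitive g + primitive f * g) has_integral
        (primitive f x * primitive g x - primitive f 0 * primitive g 0)) {0..x}"
    proof (rule fundamental_theorem_of_calculus)
      fix u assume u: "u \<in> {0..x}"
      have "((\<lambda>u. primitive f u * primitive g u) has_vector_derivative
          (primitive f u * g u + f u * primitive g u)) (at u within {0..x})"
        by (rule has_vector_derivative_mult) (use deriv f g u in auto)
      then show "((\<lambda>u. primitive f u * primitive g u) has_vector_derivative
          (f * primitive g + primitive f * g) u) (at u within {0..x})"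
        by (simp add: add.commute)
    qed (use x in auto)
    then show ?thesis using x by (simp add: primitive_def integral_unique)
  qed
  then have "primitive f * primitive g = primitive (f * primitive g + primitive f * g)"
    by (auto simp: fun_eq_iff) (auto simp: primitive_def)
  also have "\<dots> = primitive (f * primitive g) + primitive (primitive f * g)"
    using f g cont by (intro add) (auto simp: times_fun_def intro!: continuous_intros)
  finally show "primitive f * primitive g = primitive (f * primitive g) + primitive (primitive f * g)" .
qed (auto simp: one_fun_def)

lemma smooth_funs_continuous: "f \<in> smooth_funs \<Longrightarrow> continuous_on {0..1} f"
  unfolding smooth_funs_def by (blast intro: DERIV_continuous_on)

lemma smooth_funs_integrable:
  assumes "f \<in> smooth_funs"
  shows "integrable lborel f"
proof -
  have "integrable lborel (\<lambda>x. indicator {0..1} x *\<^sub>R f x)"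
    using borel_integrable_atLeastAtMost'[OF smooth_funs_continuous[OF assms]]
    by (simp add: set_integrable_def)
  also have "(\<lambda>x. indicator {0..1} x *\<^sub>R f x) = f"
    using assms by (auto simp: smooth_funs_def fun_eq_iff indicator_def)
  finally show ?thesis .
qed

text \<open>
  A variable upper bound \<open>x\<close> is needed for the induction on the dimension: slicing the simplex at the
  value of its last variable gives a simplex with that value as its bound.
\<close>

definition simplex_below :: "real \<Rightarrow> nat \<Rightarrow> (nat \<Rightarrow> real) set" where
  "simplex_below x n = {t. (\<forall>i\<in>{1..n}. 0 \<le> t i \<and> t i \<le> x) \<and> (\<forall>i\<in>{1..<n}. t i \<le> t (i + 1))}"

lemma simplex_below_1: "simplex_below 1 n = std_simplex n"
  by (simp add: simplex_below_def std_simplex_def)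

lemma simplex_below_Suc:
  "t \<in> simplex_below x (Suc n) \<longleftrightarrow> 0 \<le> t (Suc n) \<and> t (Suc n) \<le> x \<and> t \<in> simplex_below (t (Suc n)) n"
proof
  assume t: "t \<in> simplex_below x (Suc n)"
  have "t i \<le> t (Suc n)" if "i \<le> Suc n" "1 \<le> i" for i
    using that
  proof (induction i rule: inc_induct)
    case (step i)
    then have "t i \<le> t (Suc i)" using t by (simp add: simplex_below_def)
    then show ?case using step by simp
  qed simp
  then show "0 \<le> t (Suc n) \<and> t (Suc n) \<le> x \<and> t \<in> simplex_below (t (Suc n)) n"
    using t by (auto simp: simplex_below_def)
next
  assume t: "0 \<le> t (Suc n) \<and> t (Suc n) \<le> x \<and> t \<in> simplex_below (t (Suc n)) n"
  have "t i \<le> t (Suc i)" if "i \<in> {1..<Suc n}" for i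
    using t that by (cases "i = n") (auto simp: simplex_below_def)
  moreover have "0 \<le> t i \<and> t i \<le> x" if "i \<in> {1..Suc n}" for i
  proof (cases "i = Suc n")
    case False
    then have "0 \<le> t i \<and> t i \<le> t (Suc n)" using t that by (auto simp: simplex_below_def)
    then show ?thesis using t by linarith
  qed (use t in auto)
  ultimately show "t \<in> simplex_below x (Suc n)" by (simp add: simplex_below_def)
qed

lemma simplex_below_cong:
  "(\<And>i. i \<in> {1..n} \<Longrightarrow> s i = t i) \<Longrightarrow> s \<in> simplex_below x n \<longleftrightarrow> t \<in> simplex_below x n"
  by (auto simp: simplex_below_def)

interpretation lborel_product: product_sigma_finite "\<lambda>_::nat. lborel :: real measure"
  by standard

lemma sets_simplex_below:
  "simplex_below x n \<inter> space (PiM {1..n} (\<lambda>_. lborel)) \<in> sets (PiM {1..n} (\<lambda>_. lborel))"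
proof -
  let ?M = "PiM {1..n} (\<lambda>_. lborel :: real measure)"
  have comp: "(\<lambda>t. t i) \<in> borel_measurable ?M" if "i \<in> {1..n}" for i
    using measurable_component_singleton[OF that, of "\<lambda>_. lborel"] by simp
  have "{t \<in> space ?M. (\<forall>i\<in>{1..n}. 0 \<le> t i \<and> t i \<le> x) \<and> (\<forall>i\<in>{1..<n}. t i \<le> t (i + 1))} \<in> sets ?M"
    by (intro sets.sets_Collect_conj sets.sets_Collect_finite_All borel_measurable_le
        borel_measurable_const comp) auto
  also have "{t \<in> space ?M. (\<forall>i\<in>{1..n}. 0 \<le> t i \<and> t i \<le> x) \<and> (\<forall>i\<in>{1..<n}. t i \<le> t (i + 1))} =
      simplex_below x n \<inter> space ?M"
    by (auto simp: simplex_below_def)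
  finally show ?thesis .
qed

lemma integrable_simplex_below:
  assumes "range a \<subseteq> smooth_funs"
  shows "integrable (PiM {1..n} (\<lambda>_. lborel))
     (\<lambda>t. indicator (simplex_below x n) t * (\<Prod>i = 1..n. a i (t i)))"
proof -
  let ?M = "PiM {1..n} (\<lambda>_. lborel :: real measure)"
  have "integrable ?M (\<lambda>t. \<Prod>i\<in>{1..n}. a i (t i))"
    by (rule lborel_product.product_integrable_prod) (use assms in \<open>auto intro!: smooth_funs_integrable\<close>)
  then have "integrable ?M (\<lambda>t. indicator (simplex_below x n \<inter> space ?M) t *\<^sub>R (\<Prod>i\<in>{1..n}. a i (t i)))"
    by (rule integrable_mult_indicator[OF sets_simplex_below])
  then show ?thesis
    by (rule Bochner_Integration.integrable_cong[THEN iffD1, rotated -1]) (auto simp: indicator_def)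
qed

text \<open>
  Fubini, with the last variable outermost: the inner integral is the induction hypothesis at the
  bound \<open>t (Suc n)\<close>, and the outer one forms the primitive.
\<close>

lemma integral_simplex_below:
  assumes a: "range a \<subseteq> smooth_funs" and "x \<in> {0..1}"
  shows "(\<integral>t. indicator (simplex_below x n) t * (\<Prod>i = 1..n. a i (t i)) \<partial>PiM {1..n} (\<lambda>_. lborel)) =
    smooth.nested (rev (map a [1..<Suc n])) x"
  using assms(2)
proof (induction n arbitrary: x)
  case 0
  show ?case by (simp add: simplex_below_def PiM_empty lebesgue_integral_count_space_finite)
next
  case (Suc n)
  define M where "M J = PiM J (\<lambda>_::nat. lborel :: real measure)" for J
  define F where "F x n t = indicator (simplex_below x n) t * (\<Prod>i = 1..n. a i (t i))" for x n and t :: "nat \<Rightarrow> real"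
  define G where "G = smooth.nested (rev (map a [1..<Suc n]))"
  define H where "H c = indicator {0..x} c *\<^sub>R (a (Suc n) * G) c" for c
  have a_cont: "continuous_on {0..1} (a i)" for i
    using a by (auto intro: smooth_funs_continuous)
  have "G \<in> {f. continuous_on {0..1} f}"
    unfolding G_def by (rule smooth.nested_mem) (use a_cont in auto)
  then have "continuous_on {0..1} (a (Suc n) * G)"
    using a_cont by (auto simp: times_fun_def intro!: continuous_intros)
  then have cont: "continuous_on {0..x} (a (Suc n) * G)"
    by (rule continuous_on_subset) (use Suc.prems in auto)
  \<comment> \<open>\<open>u\<close> carries the last variable and \<open>v\<close> the remaining ones\<close>
  have inner: "(\<integral>v. F x (Suc n) (merge {Suc n} {1..n} (u, v)) \<partial>M {1..n}) = H (u (Suc n))" for u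
  proof -
    let ?c = "u (Suc n)"
    have "F x (Suc n) (merge {Suc n} {1..n} (u, v)) =
        indicator {0..x} ?c * a (Suc n) ?c * F ?c n v" for v
    proof -
      let ?t = "merge {Suc n} {1..n} (u, v)"
      have t: "?t (Suc n) = ?c" "i \<in> {1..n} \<Longrightarrow> ?t i = v i" for i
        by (auto simp: merge_def)
      have "indicator (simplex_below x (Suc n)) ?t =
          indicator {0..x} ?c * (indicator (simplex_below ?c n) v :: real)"
        using simplex_below_Suc[of ?t x n] simplex_below_cong[of n ?t v, OF t(2)] t(1)
        by (auto simp: indicator_def)
      moreover have "(\<Prod>i = 1..Suc n. a i (?t i)) = (\<Prod>i = 1..n. a i (v i)) * a (Suc n) ?c"
        using t by simp
      ultimately show ?thesis by (simp add: F_def mult_ac)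
    qed
    then have "(\<integral>v. F x (Suc n) (merge {Suc n} {1..n} (u, v)) \<partial>M {1..n}) =
        indicator {0..x} ?c * a (Suc n) ?c * (\<integral>v. F ?c n v \<partial>M {1..n})"
      by simp
    also have "\<dots> = H ?c"
      using Suc.IH[of ?c] Suc.prems by (auto simp: H_def F_def M_def G_def indicator_def simp del: upt_Suc)
    finally show ?thesis .
  qed
  have eq: "{1..Suc n} = {Suc n} \<union> {1..n}" by auto
  have int: "integrable (M {1..Suc n}) (F x (Suc n))"
    unfolding F_def M_def by (rule integrable_simplex_below[OF a])
  have "(\<integral>t. F x (Suc n) t \<partial>M {1..Suc n}) =
      (\<integral>u. (\<integral>v. F x (Suc n) (merge {Suc n} {1..n} (u, v)) \<partial>M {1..n}) \<partial>M {Suc n})"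
    unfolding eq M_def
    by (rule lborel_product.product_integral_fold)
      (use int in \<open>simp_all only: M_def eq\<close>, simp_all)
  also have "\<dots> = (\<integral>u. H (u (Suc n)) \<partial>M {Suc n})"
    by (simp only: inner)
  also have "\<dots> = integral\<^sup>L lborel H"
    unfolding M_def
    by (rule lborel_product.product_integral_singleton)
      (use borel_integrable_atLeastAtMost'[OF cont] in \<open>auto simp: H_def set_integrable_def\<close>)
  also have "\<dots> = integral {0..x} (a (Suc n) * G)"
    using set_borel_integral_eq_integral(2)[OF borel_integrable_atLeastAtMost'[OF cont]]
    unfolding H_def[abs_def] set_lebesgue_integral_def .
  also have "\<dots> = smooth.nested (rev (map a [1..<Suc (Suc n)])) x"
    using Suc.prems by (simp add: G_def primitive_def)
  finally show ?case by (simp add: F_def M_def)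
qed

lemma simplex_integral_eq_nested:
  assumes "set as \<subseteq> smooth_funs"
  shows "simplex_integral (length as) (\<lambda>t. \<Prod>i = 1..length as. (as ! (i - 1)) (t i)) =
    smooth.nested (rev as) 1"
    and "set_integrable (PiM {1..length as} (\<lambda>_. lborel)) (std_simplex (length as))
      (\<lambda>t. \<Prod>i = 1..length as. (as ! (i - 1)) (t i))"
proof -
  have "(0 :: real \<Rightarrow> real) \<in> smooth_funs"
    by (auto simp: smooth_funs_def intro!: exI[of _ "\<lambda>_ _. 0"])
  define a where "a i = (if i \<in> {1..length as} then as ! (i - 1) else 0)" for i
  have a: "range a \<subseteq> smooth_funs"
    using assms \<open>0 \<in> smooth_funs\<close> nth_mem by (fastforce simp: a_def)
  have "map a [1..<Suc (length as)] = as"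
    by (rule nth_equalityI) (auto simp: a_def simp del: upt_Suc)
  moreover have "(\<Prod>i = 1..length as. a i (t i)) = (\<Prod>i = 1..length as. (as ! (i - 1)) (t i))" for t
    by (rule prod.cong) (auto simp: a_def)
  ultimately show "simplex_integral (length as) (\<lambda>t. \<Prod>i = 1..length as. (as ! (i - 1)) (t i)) =
      smooth.nested (rev as) 1"
    and "set_integrable (PiM {1..length as} (\<lambda>_. lborel)) (std_simplex (length as))
      (\<lambda>t. \<Prod>i = 1..length as. (as ! (i - 1)) (t i))"
    using integral_simplex_below[OF a, of 1 "length as"] integrable_simplex_below[OF a, of "length as" 1]
    by (simp_all add: simplex_integral_def set_lebesgue_integral_def set_integrable_def simplex_below_1)
qed

lemma simplex_integral_sum:
  assumes "\<And>x. x \<in> A \<Longrightarrow> set_integrable (PiM {1..n} (\<lambda>_. lborel)) (std_simplex n) (f x)"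
  shows "simplex_integral n (\<lambda>t. \<Sum>x\<in>A. c x * f x t) = (\<Sum>x\<in>A. c x * simplex_integral n (f x))"
proof -
  let ?M = "PiM {1..n} (\<lambda>_. lborel :: real measure)"
  have "(\<integral>t. (\<Sum>x\<in>A. c x * (indicator (std_simplex n) t * f x t)) \<partial>?M) =
      (\<Sum>x\<in>A. c x * (\<integral>t. indicator (std_simplex n) t * f x t \<partial>?M))"
    using assms by (subst Bochner_Integration.integral_sum) (auto simp: set_integrable_def)
  then show ?thesis
    by (simp add: simplex_integral_def set_lebesgue_integral_def sum_distrib_left mult.left_commute)
qed

text \<open>
  Renaming the variables in \<open>a\<^sub>i (t\<^bsub>\<sigma> i\<^esub>)\<close> turns each summand of the integrand into the integrand
  of an iterated integral of the reordered functions.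
\<close>

lemma log_lambda_one_forms_smooth:
  assumes lam: "is_lambda_smooth \<Lambda>" and L: "is_log L"
    and n: "n \<ge> 1" "length as = n" and as: "set as \<subseteq> smooth_funs"
  shows "ainf_comp L \<Lambda> (map one_form as) =
    cochain_scale
      (simplex_integral n (\<lambda>t.
         1 / real n *
         (\<Sum>\<sigma> | \<sigma> permutes {1..n}.
            (- 1) ^ descent_number n \<sigma> / real ((n - 1) choose descent_number n \<sigma>) *
            (\<Prod>i = 1..n. (as ! (i - 1)) (t (\<sigma> i))))))
      cochain_dt"
proof -
  define I where "I as = simplex_integral (length as) (\<lambda>t. \<Prod>i = 1..length as. (as ! (i - 1)) (t i))" for as
  \<comment> \<open>any member of the list may serve as value outside the range, to keep all values smooth\<close>
  define a where "a i = (if i \<in> {1..n} then as ! (i - 1) else as ! 0)" for i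
  define c where "c \<sigma> = (- 1) ^ descent_number n \<sigma> / real ((n - 1) choose descent_number n \<sigma>)" for \<sigma>
  define w where "w \<sigma> = map a (map (inv \<sigma>) [1..<Suc n])" for \<sigma>
  have a: "range a \<subseteq> smooth_funs"
    using as n nth_mem[of _ as] by (fastforce simp: a_def)
  then have a_cont: "range a \<subseteq> {f. continuous_on {0..1} f}"
    using smooth_funs_continuous by blast
  have as_eq: "map a [1..<Suc n] = as"
    using n by (intro nth_equalityI) (auto simp: a_def simp del: upt_Suc)
  have I: "I (map a v) = smooth.nested (rev (map a v)) 1" for v
    unfolding I_def by (rule simplex_integral_eq_nested) (use a in auto)
  have "ainf_comp L \<Lambda> (map one_form (map a [1..<Suc n])) =
    cochain_scale (\<Sum>\<sigma> | \<sigma> permutes {1..n}.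
        1 / of_nat n * ((- 1) ^ descent_number n \<sigma> / of_nat ((n - 1) choose descent_number n \<sigma>)) *
        I (map a (map (inv \<sigma>) [1..<Suc n]))) cochain_dt"
  proof (rule log_lambda_one_forms[OF _ L a n(1)])
    show "is_lambda Omega_smooth smooth_funs (\<lambda>(f, a). (f 1, f 0, integral {0..1} a)) I \<Lambda>"
      using lam by (simp add: is_lambda_smooth_def I_def[abs_def])
    show "I [] = 1" using I[of "[]"] by simp
    show "I (map a us) * I (map a vs) = (\<Sum>ws\<in>shuffles us vs. I (map a ws))"
      if "distinct (us @ vs)" for us vs
      unfolding I using smooth.eval_nested_rev_shuffle[OF _ _ a_cont that, of "\<lambda>f. f 1"] by simp
  qed
  also have "(\<Sum>\<sigma> | \<sigma> permutes {1..n}.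
        1 / of_nat n * ((- 1) ^ descent_number n \<sigma> / of_nat ((n - 1) choose descent_number n \<sigma>)) *
        I (map a (map (inv \<sigma>) [1..<Suc n]))) =
      (\<Sum>\<sigma> | \<sigma> permutes {1..n}. 1 / real n * c \<sigma> * I (w \<sigma>))"
    by (simp add: c_def w_def)
  also have "\<dots> = simplex_integral n (\<lambda>t. \<Sum>\<sigma> | \<sigma> permutes {1..n}.
      1 / real n * c \<sigma> * (\<Prod>i = 1..n. (w \<sigma> ! (i - 1)) (t i)))"
  proof -
    have w: "length (w \<sigma>) = n" "set (w \<sigma>) \<subseteq> smooth_funs" for \<sigma>
      using a by (auto simp: w_def simp del: upt_Suc)
    show ?thesis
      using simplex_integral_eq_nested(2)[OF w(2)]
      by (subst simplex_integral_sum) (simp_all only: I_def w(1))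
  qed
  also have "\<dots> = simplex_integral n (\<lambda>t.
         1 / real n *
         (\<Sum>\<sigma> | \<sigma> permutes {1..n}. c \<sigma> * (\<Prod>i = 1..n. (as ! (i - 1)) (t (\<sigma> i)))))"
  proof -
    have "(\<Prod>i = 1..n. (w \<sigma> ! (i - 1)) (t i)) = (\<Prod>i = 1..n. (as ! (i - 1)) (t (\<sigma> i)))"
      if "\<sigma> permutes {1..n}" for \<sigma> t
      using prod_permutes_eq[OF that, of "\<lambda>f i. f (t i)" a] by (simp add: w_def a_def del: upt_Suc)
    then show ?thesis by (simp add: sum_distrib_left mult.assoc)
  qed
  finally show ?thesis unfolding as_eq c_def .
qed

section \<open>Polynomial forms\<close>

definition poly_primitive :: "'k::field_char_0 poly \<Rightarrow> 'k poly" where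
  "poly_primitive p = (\<Sum>i\<le>degree p. monom (coeff p i / of_nat (Suc i)) (Suc i))"

lemma coeff_poly_primitive: "coeff (poly_primitive p) k = (case k of 0 \<Rightarrow> 0 | Suc i \<Rightarrow> coeff p i / of_nat (Suc i))"
proof (cases k)
  case (Suc i)
  have "coeff (poly_primitive p) (Suc i) = (\<Sum>j\<le>degree p. if j = i then coeff p i / of_nat (Suc i) else 0)"
    unfolding poly_primitive_def coeff_sum by (rule sum.cong) (auto simp del: of_nat_Suc)
  also have "\<dots> = coeff p i / of_nat (Suc i)"
    by (cases "i \<le> degree p") (simp_all add: coeff_eq_0 del: of_nat_Suc)
  finally show ?thesis by (simp add: Suc)
qed (simp add: poly_primitive_def coeff_sum)

lemma poly_primitive_add: "poly_primitive (p + q) = poly_primitive p + poly_primitive q"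
  by (rule poly_eqI) (simp add: coeff_poly_primitive add_divide_distrib split: nat.split)

lemma poly_primitive_sum: "poly_primitive (\<Sum>x\<in>A. f x) = (\<Sum>x\<in>A. poly_primitive (f x))"
proof (induction A rule: infinite_finite_induct)
  case empty
  show ?case by (simp add: poly_primitive_def)
qed (simp_all add: poly_primitive_add, simp add: poly_primitive_def)

lemma poly_primitive_monom: "poly_primitive (monom c k) = monom (c / of_nat (Suc k)) (Suc k)"
  by (rule poly_eqI) (auto simp: coeff_poly_primitive split: nat.split)

lemma poly_primitive_pderiv:
  assumes "coeff p 0 = 0"
  shows "poly_primitive (pderiv p) = p"
  using assms by (intro poly_eqI) (auto simp: coeff_poly_primitive coeff_pderiv split: nat.split simp del: of_nat_Suc)

lemma pderiv_poly_primitive: "pderiv (poly_primitive p) = p"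
  by (rule poly_eqI) (simp add: coeff_poly_primitive coeff_pderiv del: of_nat_Suc)

text \<open>
  The two sides of the product identity have the same derivative and vanish at \<open>0\<close>, which makes
  them equal in characteristic zero.
\<close>

interpretation formal: rota_baxter "UNIV :: 'k::field_char_0 poly set" poly_primitive
proof
  fix f g :: "'k poly"
  have "poly_primitive f * poly_primitive g = poly_primitive (pderiv (poly_primitive f * poly_primitive g))"
    by (rule poly_primitive_pderiv[symmetric]) (simp add: coeff_mult_0 coeff_poly_primitive)
  also have "\<dots> = poly_primitive (f * poly_primitive g + poly_primitive f * g)"
    by (simp add: pderiv_mult pderiv_poly_primitive algebra_simps)
  finally show "poly_primitive f * poly_primitive g = poly_primitive (f * poly_primitive g) + poly_primitive (poly_primitive f * g)"
    by (simp only: poly_primitive_add)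
qed (simp_all add: poly_primitive_add)

definition linear_extension :: "((nat \<Rightarrow>\<^sub>0 nat) \<Rightarrow> 'k poly) \<Rightarrow> 'k::comm_ring_1 multipoly \<Rightarrow> 'k poly" where
  "linear_extension h Q = (\<Sum>m\<in>Poly_Mapping.keys Q. smult (Poly_Mapping.lookup Q m) (h m))"

lemma linear_extension_superset:
  assumes "finite K" "Poly_Mapping.keys Q \<subseteq> K"
  shows "linear_extension h Q = (\<Sum>m\<in>K. smult (Poly_Mapping.lookup Q m) (h m))"
  unfolding linear_extension_def
  by (rule sum.mono_neutral_left) (use assms in \<open>auto simp: in_keys_iff\<close>)

lemma linear_extension_add:
  "linear_extension h (Q + R) = linear_extension h Q + linear_extension h R"
proof -
  let ?K = "Poly_Mapping.keys Q \<union> Poly_Mapping.keys R"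
  have "Poly_Mapping.keys (Q + R) \<subseteq> ?K" by (rule keys_add)
  then show ?thesis
    by (simp add: linear_extension_superset[of ?K] lookup_add smult_add_left sum.distrib)
qed

lemma linear_extension_sum:
  "linear_extension h (\<Sum>x\<in>A. f x) = (\<Sum>x\<in>A. linear_extension h (f x))"
  by (induction A rule: infinite_finite_induct)
    (simp_all add: linear_extension_add, simp_all add: linear_extension_def)

lemma linear_extension_single:
  "linear_extension h (Poly_Mapping.single m c) = smult c (h m)"
  by (subst linear_extension_superset[of "{m}"]) auto

lemma multipoly_eq_sum_single:
  "Q = (\<Sum>m\<in>Poly_Mapping.keys Q. Poly_Mapping.single m (Poly_Mapping.lookup Q m))"
proof (rule poly_mapping_eqI)
  fix k
  have "(\<Sum>m\<in>Poly_Mapping.keys Q. Poly_Mapping.lookup (Poly_Mapping.single m (Poly_Mapping.lookup Q m)) k) =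
      (\<Sum>m\<in>Poly_Mapping.keys Q. if m = k then Poly_Mapping.lookup Q k else 0)"
    by (rule sum.cong) (auto simp: lookup_single)
  then show "Poly_Mapping.lookup Q k = Poly_Mapping.lookup
      (\<Sum>m\<in>Poly_Mapping.keys Q. Poly_Mapping.single m (Poly_Mapping.lookup Q m)) k"
    by (simp add: lookup_sum in_keys_iff)
qed

text \<open>
  The formal integral over \<open>0 \<le> t\<^sub>1 \<le> \<dots> \<le> t\<^sub>n \<le> s\<close> as a polynomial in the upper bound \<open>s\<close>: a
  monomial contributes \<open>s\<^bsup>l\<^sub>1 + \<dots> + l\<^sub>n\<^esup> / (l\<^sub>1 (l\<^sub>1 + l\<^sub>2) \<dots> (l\<^sub>1 + \<dots> + l\<^sub>n))\<close>, where
  \<open>l\<^sub>i\<close> is the exponent of \<open>t\<^sub>i\<close> plus one.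
\<close>

definition formal_primitive :: "nat \<Rightarrow> 'k::field_char_0 multipoly \<Rightarrow> 'k poly" where
  "formal_primitive n = linear_extension (\<lambda>m.
     monom (1 / (\<Prod>j = 1..n. \<Sum>i = 1..j. of_nat (Poly_Mapping.lookup m i + 1)))
       (\<Sum>i = 1..n. Poly_Mapping.lookup m i + 1))"

lemma poly_formal_primitive: "poly (formal_primitive n Q) 1 = formal_simplex_integral n Q"
  by (simp add: formal_primitive_def linear_extension_def formal_simplex_integral_def poly_sum poly_monom)

lemma formal_simplex_integral_sum:
  "formal_simplex_integral n (\<Sum>x\<in>A. f x) = (\<Sum>x\<in>A. formal_simplex_integral n (f x))"
  by (simp add: poly_formal_primitive[symmetric] formal_primitive_def linear_extension_sum poly_sum)

lemma formal_simplex_integral_const_mult: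
  "formal_simplex_integral n (multipoly_const c * Q) = c * formal_simplex_integral n Q"
proof -
  have "multipoly_const c * Q =
      (\<Sum>m\<in>Poly_Mapping.keys Q. Poly_Mapping.single m (c * Poly_Mapping.lookup Q m))"
    by (subst multipoly_eq_sum_single[of Q])
      (simp add: multipoly_const_def sum_distrib_left mult_single)
  then have "linear_extension h (multipoly_const c * Q) = smult c (linear_extension h Q)" for h
    by (simp add: linear_extension_sum linear_extension_single)
      (simp add: linear_extension_def poly_eq_iff coeff_sum sum_distrib_left mult.assoc)
  then show ?thesis
    by (simp add: poly_formal_primitive[symmetric] formal_primitive_def)
qed

text \<open>
  The formal counterpart of Fubini. On monomials, the exponent \<open>l\<^sub>1 + \<dots> + l\<^sub>n\<close> of the inner
  integral enlarged by \<open>l\<^bsub>n+1\<^esub>\<close> is the new factor \<open>l\<^sub>1 + \<dots> + l\<^bsub>n+1\<^esub>\<close> of the denominator, which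
  the formation of a primitive supplies.
\<close>

lemma formal_primitive_mult_var:
  assumes Q: "\<And>m. m \<in> Poly_Mapping.keys Q \<Longrightarrow> Poly_Mapping.lookup m (Suc n) = 0"
  shows "formal_primitive (Suc n) (Q * poly_in_var (Suc n) p) = poly_primitive (p * formal_primitive n Q)"
proof -
  let ?q = "Poly_Mapping.lookup Q"
  define T where "T n m = (\<Sum>i = 1..n. Poly_Mapping.lookup m i + 1)" for n and m :: "nat \<Rightarrow>\<^sub>0 nat"
  define den :: "nat \<Rightarrow> (nat \<Rightarrow>\<^sub>0 nat) \<Rightarrow> 'a" where "den n m = (\<Prod>j = 1..n. of_nat (T j m))" for n m
  have prim: "formal_primitive n = linear_extension (\<lambda>m. monom (1 / den n m) (T n m))" for n
    by (simp add: formal_primitive_def T_def den_def)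
  have "Q * poly_in_var (Suc n) p = (\<Sum>m\<in>Poly_Mapping.keys Q. \<Sum>i\<le>degree p.
      Poly_Mapping.single (m + Poly_Mapping.single (Suc n) i) (?q m * coeff p i))"
    by (subst multipoly_eq_sum_single[of Q]) (simp add: poly_in_var_def sum_product mult_single)
  then have "formal_primitive (Suc n) (Q * poly_in_var (Suc n) p) =
      (\<Sum>m\<in>Poly_Mapping.keys Q. \<Sum>i\<le>degree p. smult (?q m * coeff p i)
        (monom (1 / den (Suc n) (m + Poly_Mapping.single (Suc n) i))
          (T (Suc n) (m + Poly_Mapping.single (Suc n) i))))"
    by (simp add: prim linear_extension_sum linear_extension_single)
  also have "\<dots> = (\<Sum>m\<in>Poly_Mapping.keys Q. \<Sum>i\<le>degree p.
      poly_primitive (monom (coeff p i) i * smult (?q m) (monom (1 / den n m) (T n m))))"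
  proof (intro sum.cong refl)
    fix m i assume m: "m \<in> Poly_Mapping.keys Q"
    let ?m = "m + Poly_Mapping.single (Suc n) i"
    have T_le: "T j ?m = T j m" if "j \<le> n" for j
      unfolding T_def by (rule sum.cong) (use that in \<open>auto simp: lookup_add lookup_single\<close>)
    have T_Suc: "T (Suc n) ?m = Suc (i + T n m)"
      using T_le[of n] Q[OF m] by (simp add: T_def lookup_add)
    have "den n ?m = den n m"
      unfolding den_def by (rule prod.cong) (simp_all add: T_le)
    then have den_Suc: "den (Suc n) ?m = den n m * of_nat (Suc (i + T n m))"
      using T_Suc by (simp add: den_def)
    show "smult (?q m * coeff p i) (monom (1 / den (Suc n) ?m) (T (Suc n) ?m)) =
        poly_primitive (monom (coeff p i) i * smult (?q m) (monom (1 / den n m) (T n m)))"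
      by (simp add: T_Suc den_Suc smult_monom mult_monom poly_primitive_monom mult_ac del: of_nat_Suc)
  qed
  also have "\<dots> = poly_primitive (\<Sum>m\<in>Poly_Mapping.keys Q. \<Sum>i\<le>degree p.
      monom (coeff p i) i * smult (?q m) (monom (1 / den n m) (T n m)))"
    by (simp only: poly_primitive_sum)
  also have "(\<Sum>m\<in>Poly_Mapping.keys Q. \<Sum>i\<le>degree p.
      monom (coeff p i) i * smult (?q m) (monom (1 / den n m) (T n m))) = p * formal_primitive n Q"
    unfolding prim linear_extension_def
    by (subst sum.swap) (simp only: sum_product[symmetric] poly_as_sum_of_monoms)
  finally show ?thesis .
qed

lemma keys_prod_poly_in_var:
  assumes "m \<in> Poly_Mapping.keys (\<Prod>i = 1..n. poly_in_var i (a i))" "n < k"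
  shows "Poly_Mapping.lookup m k = 0"
  using assms
proof (induction n arbitrary: m)
  case 0
  then show ?case by simp
next
  case (Suc n)
  have "m \<in> Poly_Mapping.keys ((\<Prod>i = 1..n. poly_in_var i (a i)) * poly_in_var (Suc n) (a (Suc n)))"
    using Suc.prems(1) by simp
  then obtain m1 m2 where m: "m = m1 + m2" "m1 \<in> Poly_Mapping.keys (\<Prod>i = 1..n. poly_in_var i (a i))"
    "m2 \<in> Poly_Mapping.keys (poly_in_var (Suc n) (a (Suc n)))"
    using subsetD[OF keys_mult] by blast
  obtain i where "m2 \<in> Poly_Mapping.keys (Poly_Mapping.single (Poly_Mapping.single (Suc n) i) (coeff (a (Suc n)) i))"
    using subsetD[OF keys_sum m(3)[unfolded poly_in_var_def]] by blast
  then have "m2 = Poly_Mapping.single (Suc n) i" by (simp split: if_splits)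
  then show ?case using m(1) Suc.IH[OF m(2)] Suc.prems(2) by (simp add: lookup_add lookup_single)
qed

lemma formal_primitive_eq_nested:
  "formal_primitive n (\<Prod>i = 1..n. poly_in_var i (a i)) = formal.nested (rev (map a [1..<Suc n]))"
proof (induction n)
  case 0
  show ?case
    using linear_extension_single[of _ 0 "1::'a"]
    by (simp add: formal_primitive_def single_one one_pCons monom_0)
next
  case (Suc n)
  have "formal_primitive (Suc n) (\<Prod>i = 1..Suc n. poly_in_var i (a i)) =
      formal_primitive (Suc n) ((\<Prod>i = 1..n. poly_in_var i (a i)) * poly_in_var (Suc n) (a (Suc n)))"
    by simp
  also have "\<dots> = poly_primitive (a (Suc n) * formal_primitive n (\<Prod>i = 1..n. poly_in_var i (a i)))"
    by (rule formal_primitive_mult_var, erule keys_prod_poly_in_var) (rule lessI)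
  also have "\<dots> = poly_primitive (a (Suc n) * formal.nested (rev (map a [1..<Suc n])))"
    by (simp only: Suc.IH)
  also have "\<dots> = formal.nested (rev (map a ([1..<Suc n] @ [Suc n])))"
    by (simp del: upt_Suc)
  finally show ?case by simp
qed

lemma formal_simplex_integral_eq_nested:
  "formal_simplex_integral (length as) (\<Prod>i = 1..length as. poly_in_var i (as ! (i - 1))) =
     poly (formal.nested (rev as)) 1"
proof -
  have "map (\<lambda>i. as ! (i - 1)) [1..<Suc (length as)] = as"
    by (rule nth_equalityI) (auto simp del: upt_Suc)
  then show ?thesis
    using formal_primitive_eq_nested[of "length as" "\<lambda>i. as ! (i - 1)"]
    by (simp add: poly_formal_primitive[symmetric])
qed

lemma log_lambda_one_forms_poly:
  fixes \<Lambda> :: "('k::field_char_0 poly \<times> 'k poly) list \<Rightarrow> 'k cochain"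
  assumes lam: "is_lambda_poly \<Lambda>" and L: "is_log L"
    and n: "n \<ge> 1" "length as = n"
  shows "ainf_comp L \<Lambda> (map one_form as) =
    cochain_scale
      (formal_simplex_integral n
         (multipoly_const (1 / of_nat n) *
         (\<Sum>\<sigma> | \<sigma> permutes {1..n}.
            multipoly_const
              ((- 1) ^ descent_number n \<sigma> / of_nat ((n - 1) choose descent_number n \<sigma>)) *
            (\<Prod>i = 1..n. poly_in_var (\<sigma> i) (as ! (i - 1))))))
      cochain_dt"
proof -
  define I :: "'k poly list \<Rightarrow> 'k" where
    "I as = formal_simplex_integral (length as) (\<Prod>i = 1..length as. poly_in_var i (as ! (i - 1)))" for as
  define a where "a i = as ! (i - 1)" for i
  have as_eq: "map a [1..<Suc n] = as"
    using n by (intro nth_equalityI) (auto simp: a_def simp del: upt_Suc)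
  have I: "I v = poly (formal.nested (rev v)) 1" for v
    unfolding I_def by (rule formal_simplex_integral_eq_nested)
  have "ainf_comp L \<Lambda> (map one_form (map a [1..<Suc n])) =
    cochain_scale (\<Sum>\<sigma> | \<sigma> permutes {1..n}.
        1 / of_nat n * ((- 1) ^ descent_number n \<sigma> / of_nat ((n - 1) choose descent_number n \<sigma>)) *
        I (map a (map (inv \<sigma>) [1..<Suc n]))) cochain_dt"
  proof (rule log_lambda_one_forms[OF _ L subset_UNIV n(1)])
    show "is_lambda Omega_poly UNIV
       (\<lambda>(f, a). (poly f 1, poly f 0, \<Sum>i\<le>degree a. coeff a i / of_nat (i + 1))) I \<Lambda>"
      using lam by (simp add: is_lambda_poly_def I_def[abs_def])
    show "I [] = 1" by (simp add: I)
    show "I (map a us) * I (map a vs) = (\<Sum>ws\<in>shuffles us vs. I (map a ws))"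
      if "distinct (us @ vs)" for us vs
      unfolding I using formal.eval_nested_rev_shuffle[OF _ _ subset_UNIV that, of "\<lambda>f. poly f 1"] by simp
  qed
  also have "(\<Sum>\<sigma> | \<sigma> permutes {1..n}.
        1 / of_nat n * ((- 1) ^ descent_number n \<sigma> / of_nat ((n - 1) choose descent_number n \<sigma>)) *
        I (map a (map (inv \<sigma>) [1..<Suc n]))) =
      formal_simplex_integral n
         (multipoly_const (1 / of_nat n) *
         (\<Sum>\<sigma> | \<sigma> permutes {1..n}.
            multipoly_const
              ((- 1) ^ descent_number n \<sigma> / of_nat ((n - 1) choose descent_number n \<sigma>)) *
            (\<Prod>i = 1..n. poly_in_var (\<sigma> i) (as ! (i - 1)))))"
    unfolding formal_simplex_integral_const_mult formal_simplex_integral_sum sum_distrib_left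
  proof (rule sum.cong[OF refl])
    fix \<sigma> assume "\<sigma> \<in> {\<sigma>. \<sigma> permutes {1..n}}"
    then have "(\<Prod>i = 1..n. poly_in_var (\<sigma> i) (as ! (i - 1))) =
        (\<Prod>j = 1..n. poly_in_var j (map a (map (inv \<sigma>) [1..<Suc n]) ! (j - 1)))"
      using prod_permutes_eq[of \<sigma> n "\<lambda>p i. poly_in_var i p" a] by (simp add: a_def)
    then have "I (map a (map (inv \<sigma>) [1..<Suc n])) =
        formal_simplex_integral n (\<Prod>i = 1..n. poly_in_var (\<sigma> i) (as ! (i - 1)))"
      by (simp add: I_def del: upt_Suc)
    then show "1 / of_nat n * ((- 1) ^ descent_number n \<sigma> / of_nat ((n - 1) choose descent_number n \<sigma>)) *
        I (map a (map (inv \<sigma>) [1..<Suc n])) =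
        1 / of_nat n * ((- 1) ^ descent_number n \<sigma> / of_nat ((n - 1) choose descent_number n \<sigma>) *
        formal_simplex_integral n (\<Prod>i = 1..n. poly_in_var (\<sigma> i) (as ! (i - 1))))"
      by (simp only: mult.assoc)
  qed
  finally show ?thesis unfolding as_eq .
qed

section \<open>Explicit Taylor coefficients on forms\<close>

theorem theorem2p2:
  fixes lambdaS :: "((real \<Rightarrow> real) \<times> (real \<Rightarrow> real)) list \<Rightarrow> real cochain"
    and logS :: "real cochain list \<Rightarrow> real cochain"
    and lambdaP :: "('k::field_char_0 poly \<times> 'k poly) list \<Rightarrow> 'k cochain"
    and logP :: "'k cochain list \<Rightarrow> 'k cochain"
  shows
    "(is_lambda_smooth lambdaS \<longrightarrow> is_log logS \<longrightarrow>
       (let \<phi> = ainf_comp logS lambdaS in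
         (\<forall>xs. length xs \<ge> 2 \<longrightarrow> set xs \<subseteq> ainf_carrier Omega_smooth \<longrightarrow>
            (\<exists>x\<in>set xs. x \<in> ainf_hom Omega_smooth 0) \<longrightarrow> \<phi> xs = 0) \<and>
         (\<forall>n as. n \<ge> 2 \<longrightarrow> length as = n \<longrightarrow> set as \<subseteq> smooth_funs \<longrightarrow>
            \<phi> (map one_form as) =
              cochain_scale
                (simplex_integral n (\<lambda>t.
                   1 / real n *
                   (\<Sum>\<sigma> | \<sigma> permutes {1..n}.
                      (- 1) ^ descent_number n \<sigma> / real ((n - 1) choose descent_number n \<sigma>) *
                      (\<Prod>i = 1..n. (as ! (i - 1)) (t (\<sigma> i))))))
                cochain_dt)))
     \<and>
     (is_lambda_poly lambdaP \<longrightarrow> is_log logP \<longrightarrow>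
       (let \<phi> = ainf_comp logP lambdaP in
         (\<forall>xs. length xs \<ge> 2 \<longrightarrow> set xs \<subseteq> ainf_carrier Omega_poly \<longrightarrow>
            (\<exists>x\<in>set xs. x \<in> ainf_hom Omega_poly 0) \<longrightarrow> \<phi> xs = 0) \<and>
         (\<forall>n as. n \<ge> 2 \<longrightarrow> length as = n \<longrightarrow>
            \<phi> (map one_form as) =
              cochain_scale
                (formal_simplex_integral n
                   (multipoly_const (1 / of_nat n) *
                   (\<Sum>\<sigma> | \<sigma> permutes {1..n}.
                      multipoly_const
                        ((- 1) ^ descent_number n \<sigma> / of_nat ((n - 1) choose descent_number n \<sigma>)) *
                      (\<Prod>i = 1..n. poly_in_var (\<sigma> i) (as ! (i - 1))))))
                cochain_dt)))"
proof (intro conjI impI)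
  assume lam: "is_lambda_smooth lambdaS" and L: "is_log logS"
  have "\<pi> x \<in> cochain_hom 0"
    if "\<pi> = (\<lambda>(f, a). (f 1, f 0, integral {0..1} a))" "x \<in> ainf_hom Omega_smooth 0"
    for \<pi> :: "(real \<Rightarrow> real) \<times> (real \<Rightarrow> real) \<Rightarrow> real cochain" and x
    using that by (auto simp: Omega_smooth_def forms_def cochain_hom_def zero_fun_def)
  then show "let \<phi> = ainf_comp logS lambdaS in
      (\<forall>xs. length xs \<ge> 2 \<longrightarrow> set xs \<subseteq> ainf_carrier Omega_smooth \<longrightarrow>
         (\<exists>x\<in>set xs. x \<in> ainf_hom Omega_smooth 0) \<longrightarrow> \<phi> xs = 0) \<and>
      (\<forall>n as. n \<ge> 2 \<longrightarrow> length as = n \<longrightarrow> set as \<subseteq> smooth_funs \<longrightarrow>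
         \<phi> (map one_form as) =
           cochain_scale
             (simplex_integral n (\<lambda>t.
                1 / real n *
                (\<Sum>\<sigma> | \<sigma> permutes {1..n}.
                   (- 1) ^ descent_number n \<sigma> / real ((n - 1) choose descent_number n \<sigma>) *
                   (\<Prod>i = 1..n. (as ! (i - 1)) (t (\<sigma> i))))))
             cochain_dt)"
    unfolding Let_def
    using log_lambda_zero_form[OF lam[unfolded is_lambda_smooth_def] L]
      log_lambda_one_forms_smooth[OF lam L]
    by (intro conjI allI impI) (blast, simp)
next
  assume lam: "is_lambda_poly lambdaP" and L: "is_log logP"
  have "\<pi> x \<in> cochain_hom 0"
    if "\<pi> = (\<lambda>(f, a). (poly f 1, poly f 0, \<Sum>i\<le>degree a. coeff a i / of_nat (i + 1)))"
      "x \<in> ainf_hom Omega_poly 0"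
    for \<pi> :: "'k poly \<times> 'k poly \<Rightarrow> 'k cochain" and x
    using that by (auto simp: Omega_poly_def forms_def cochain_hom_def)
  then show "let \<phi> = ainf_comp logP lambdaP in
      (\<forall>xs. length xs \<ge> 2 \<longrightarrow> set xs \<subseteq> ainf_carrier Omega_poly \<longrightarrow>
         (\<exists>x\<in>set xs. x \<in> ainf_hom Omega_poly 0) \<longrightarrow> \<phi> xs = 0) \<and>
      (\<forall>n as. n \<ge> 2 \<longrightarrow> length as = n \<longrightarrow>
         \<phi> (map one_form as) =
           cochain_scale
             (formal_simplex_integral n
                (multipoly_const (1 / of_nat n) *
                (\<Sum>\<sigma> | \<sigma> permutes {1..n}.
                   multipoly_const
                     ((- 1) ^ descent_number n \<sigma> / of_nat ((n - 1) choose descent_number n \<sigma>)) *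
                   (\<Prod>i = 1..n. poly_in_var (\<sigma> i) (as ! (i - 1))))))
             cochain_dt)"
    unfolding Let_def
    using log_lambda_zero_form[OF lam[unfolded is_lambda_poly_def] L]
      log_lambda_one_forms_poly[OF lam L]
    by (intro conjI allI impI) (blast, simp)
qed

end
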